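(* Let $T$ be a complete first-order theory with monster model $\mathcal{U}$, let $\phi(x,y)$ be a formula, $d\in\mathbb{N}$, $A\subseteq\mathcal{U}^y$ a (small) set, and $\pi(x)$ a small partial type. Suppose that $\phi(x,y)$ is NIP and that $\mathrm{vc}^*(\phi)\leq d$. Let $k=k_{\mathrm{comp}}(d):=2^{d+1}(d-2)+d+4$. Then: (i) $S^{\pi}_{\phi\downarrow k}(A)\neq\emptyset$. (ii) If $A'\subseteq A$, then for every $l<\omega$ any $p'\in S^{\pi}_{\phi\downarrow l}(A')$ extends to some $p\in S^{\pi}_{\phi\downarrow(l+k)}(A)$. (iii) $S^{\pi}_{\phi\downarrow\star}(A)$ is dense in $S^{\pi}_{\phi}(A)$.
   Context: $\mathcal U$ is a large saturated model of $T$; small means of cardinality $<|\mathcal U|$. $\mathcal U^x$ is the set of tuples of the sort of $x$. A partial type in $x$ is a set of formulas (with parameters in $\mathcal U$) that is consistent with the elementary diagram of $\mathcal U$; $\vdash$ denotes implication in the theory of $\mathcal U$ with parameters named. $\phi(x,y)$ is NIP if the family $\{\phi(\mathcal U^x,b): b\in\mathcal U^y\}$ of subsets of $\mathcal U^x$ has finite VC-dimension; this dimension is $\mathrm{vc}(\phi)$. The dual VC-dimension $\mathrm{vc}^*(\phi)$ is the VC-dimension of the family $\{\phi(a,\mathcal U^y):a\in\mathcal U^x\}$ of subsets of $\mathcal U^y$. For $A\subseteq\mathcal U^y$, a (complete) $\phi$-type over $A$ is a maximal consistent set of formulas of the form $\phi(x,a)$ or $\neg\phi(x,a)$ with $a\in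 A$; $S_\phi(A)$ is the space of these with the logic topology (as a subspace of $2^A$), and $S^\pi_\phi(A)\subseteq S_\phi(A)$ is the closed subspace of those $\phi$-types consistent with $\pi$. For $p\in S_\phi(A)$ and $A_0\subseteq A$, $p|_{A_0}$ is the set of formulas in $p$ with parameter $a\in A_0$. $p\in S^\pi_\phi(A)$ is $k$-compressible modulo $\pi$ if for every finite $A_0\subseteq A$ there is $A_1\subseteq A$ with $|A_1|\leq k$ such that $p|_{A_1}\cup\pi\vdash p|_{A_0}$. $S^\pi_{\phi\downarrow k}(A)$ is the set of $p\in S^\pi_\phi(A)$ which are $k$-compressible modulo $\pi$, and $S^\pi_{\phi\downarrow\star}(A)=\bigcup_{k<\omega}S^\pi_{\phi\downarrow k}(A)$. *)

theory Defs
  imports "HOL-Analysis.Analysis" "HOL-Library.Extended_Nat"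
begin

unbundle cardinal_syntax

text \<open>
  Many-sorted first-order logic with equality; the single-sorted case is \<open>'s = unit\<close>.
  A variable is a sort with an index. Parameters (pairs of a sort and an element of that sort
  of the monster model) are built into the syntax as constants, so that formulas of the language
  \<open>L(B)\<close> are those all of whose parameters lie in \<open>B\<close>, and formulas of \<open>L\<close> those without parameters.
\<close>

type_synonym 's var = "'s \<times> nat"
type_synonym ('s, 'u) param = "'s \<times> 'u"

datatype ('f, tm_vars: 'v, tm_params: 'p) tm =
  Var 'v | Param 'p | App 'f "('f, 'v, 'p) tm list"

datatype ('f, 'r, 'v, fm_params: 'p) fm =
  Eq "('f, 'v, 'p) tm" "('f, 'v, 'p) tm"
| Rel 'r "('f, 'v, 'p) tm list"
| Neg "('f, 'r, 'v, 'p) fm"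
| Conj "('f, 'r, 'v, 'p) fm" "('f, 'r, 'v, 'p) fm"
| Exi 'v "('f, 'r, 'v, 'p) fm"

type_synonym ('s, 'f, 'r, 'u) form = "('f, 'r, 's var, ('s, 'u) param) fm"

primrec fv :: "('f, 'r, 'v, 'p) fm \<Rightarrow> 'v set" where
  "fv (Eq t t') = tm_vars t \<union> tm_vars t'"
| "fv (Rel r ts) = (\<Union>t\<in>set ts. tm_vars t)"
| "fv (Neg \<psi>) = fv \<psi>"
| "fv (Conj \<psi> \<theta>) = fv \<psi> \<union> fv \<theta>"
| "fv (Exi v \<psi>) = fv \<psi> - {v}"

record ('s, 'f, 'r) lang =
  fun_args :: "'f \<Rightarrow> 's list"
  fun_res :: "'f \<Rightarrow> 's"
  rel_args :: "'r \<Rightarrow> 's list"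

inductive has_sort :: "('s, 'f, 'r) lang \<Rightarrow> ('f, 's var, ('s, 'u) param) tm \<Rightarrow> 's \<Rightarrow> bool"
  for L where
  "has_sort L (Var (s, i)) s"
| "has_sort L (Param (s, u)) s"
| "list_all2 (has_sort L) ts (fun_args L f) \<Longrightarrow> has_sort L (App f ts) (fun_res L f)"

primrec wf_fm :: "('s, 'f, 'r) lang \<Rightarrow> ('s, 'f, 'r, 'u) form \<Rightarrow> bool" where
  "wf_fm L (Eq t t') \<longleftrightarrow> (\<exists>s. has_sort L t s \<and> has_sort L t' s)"
| "wf_fm L (Rel r ts) \<longleftrightarrow> list_all2 (has_sort L) ts (rel_args L r)"
| "wf_fm L (Neg \<psi>) \<longleftrightarrow> wf_fm L \<psi>"
| "wf_fm L (Conj \<psi> \<theta>) \<longleftrightarrow> wf_fm L \<psi> \<and> wf_fm L \<theta>"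
| "wf_fm L (Exi v \<psi>) \<longleftrightarrow> wf_fm L \<psi>"

definition formulas ::
  "('s, 'f, 'r) lang \<Rightarrow> ('s, 'u) param set \<Rightarrow> 's var set \<Rightarrow> ('s, 'f, 'r, 'u) form set" where
  "formulas L B X = {\<psi>. wf_fm L \<psi> \<and> fm_params \<psi> \<subseteq> B \<and> fv \<psi> \<subseteq> X}"


record ('s, 'f, 'r, 'm) struct =
  univ :: "'s \<Rightarrow> 'm set"
  fun_int :: "'f \<Rightarrow> 'm list \<Rightarrow> 'm"
  rel_int :: "'r \<Rightarrow> 'm list set"

definition tuples :: "('s, 'f, 'r, 'm) struct \<Rightarrow> 's list \<Rightarrow> 'm list set" where
  "tuples M ss = {as. list_all2 (\<lambda>a s. a \<in> univ M s) as ss}"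

abbreviation tuples_of_vars :: "('s, 'f, 'r, 'm) struct \<Rightarrow> 's var list \<Rightarrow> 'm list set" where
  "tuples_of_vars M x \<equiv> tuples M (map fst x)"

definition is_structure :: "('s, 'f, 'r) lang \<Rightarrow> ('s, 'f, 'r, 'm) struct \<Rightarrow> bool" where
  "is_structure L M \<longleftrightarrow>
     (\<forall>s. univ M s \<noteq> {}) \<and>
     (\<forall>f. \<forall>as\<in>tuples M (fun_args L f). fun_int M f as \<in> univ M (fun_res L f))"

definition elements :: "('s, 'f, 'r, 'u) struct \<Rightarrow> ('s, 'u) param set" where
  "elements M = Sigma UNIV (univ M)"

definition assignments :: "('s, 'f, 'r, 'm) struct \<Rightarrow> ('s var \<Rightarrow> 'm) set" where
  "assignments M = {e. \<forall>v. e v \<in> univ M (fst v)}"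

text \<open>In the next two functions \<open>c\<close> interprets the parameters and \<open>e\<close> the variables.\<close>

primrec eval ::
  "('s, 'f, 'r, 'm) struct \<Rightarrow> ('p \<Rightarrow> 'm) \<Rightarrow> ('v \<Rightarrow> 'm) \<Rightarrow> ('f, 'v, 'p) tm \<Rightarrow> 'm" where
  "eval M c e (Var v) = e v"
| "eval M c e (Param p) = c p"
| "eval M c e (App f ts) = fun_int M f (map (eval M c e) ts)"

primrec sat ::
  "('s, 'f, 'r, 'm) struct \<Rightarrow> ('p \<Rightarrow> 'm) \<Rightarrow> ('s var \<Rightarrow> 'm) \<Rightarrow> ('f, 'r, 's var, 'p) fm \<Rightarrow> bool" where
  "sat M c e (Eq t t') \<longleftrightarrow> eval M c e t = eval M c e t'"
| "sat M c e (Rel r ts) \<longleftrightarrow> map (eval M c e) ts \<in> rel_int M r"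
| "sat M c e (Neg \<psi>) \<longleftrightarrow> \<not> sat M c e \<psi>"
| "sat M c e (Conj \<psi> \<theta>) \<longleftrightarrow> sat M c e \<psi> \<and> sat M c e \<theta>"
| "sat M c e (Exi v \<psi>) \<longleftrightarrow> (\<exists>a\<in>univ M (fst v). sat M c (e(v := a)) \<psi>)"

text \<open>Truth of a sentence with parameters from \<open>U\<close>; in \<open>U\<close> itself a parameter \<open>(s, u)\<close> denotes \<open>u\<close>.\<close>

definition true_in :: "('s, 'f, 'r, 'u) struct \<Rightarrow> ('s, 'f, 'r, 'u) form \<Rightarrow> bool" where
  "true_in U \<sigma> \<longleftrightarrow> (\<forall>e\<in>assignments U. sat U snd e \<sigma>)"


subsection \<open>Complete theories and monster models\<close>

text \<open>
  Below, ``every structure'' means every structure whose sorts are subsets of the type \<open>'u\<close> in which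
  the sorts of the monster model \<open>U\<close> live. Under the standing assumption \<open>|L| < |U|\<close> (see \<open>monster\<close>)
  this is no restriction: then \<open>'u\<close> has at least \<open>|U|\<close> elements, and, by the downward
  Loewenheim-Skolem theorem, a set of formulas of \<open>L\<close> or of \<open>L(U)\<close> (in at most \<open>|U|\<close> variables) that
  is satisfiable at all is satisfiable in a structure of cardinality at most \<open>|U|\<close>.
\<close>

definition models ::
  "('s, 'f, 'r) lang \<Rightarrow> ('s, 'f, 'r, 'u) struct \<Rightarrow> ('s, 'f, 'r, 'u) form set \<Rightarrow> bool" where
  "models L M T \<longleftrightarrow> is_structure L M \<and> (\<forall>\<sigma>\<in>T. true_in M \<sigma>)"

definition complete_theory :: "('s, 'f, 'r) lang \<Rightarrow> ('s, 'f, 'r, 'u) form set \<Rightarrow> bool" where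
  "complete_theory L T \<longleftrightarrow>
     T \<subseteq> formulas L {} {} \<and>
     (\<exists>M :: ('s, 'f, 'r, 'u) struct. models L M T) \<and>
     (\<forall>\<sigma>\<in>formulas L {} {}.
        (\<forall>M :: ('s, 'f, 'r, 'u) struct. models L M T \<longrightarrow> true_in M \<sigma>) \<or>
        (\<forall>M :: ('s, 'f, 'r, 'u) struct. models L M T \<longrightarrow> true_in M (Neg \<sigma>)))"

definition small :: "('s, 'f, 'r, 'u) struct \<Rightarrow> 'a set \<Rightarrow> bool" where
  "small U X \<longleftrightarrow> |X| <o |elements U|"

text \<open>A set of formulas in one variable is a type in \<open>U\<close> when it is finitely satisfiable in \<open>U\<close>.\<close>

definition saturated :: "('s, 'f, 'r) lang \<Rightarrow> ('s, 'f, 'r, 'u) struct \<Rightarrow> bool" where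
  "saturated L U \<longleftrightarrow>
     (\<forall>B v \<Sigma>. B \<subseteq> elements U \<and> small U B \<and> \<Sigma> \<subseteq> formulas L B {v} \<and>
        (\<forall>\<Sigma>\<^sub>0\<subseteq>\<Sigma>. finite \<Sigma>\<^sub>0 \<longrightarrow> (\<exists>e\<in>assignments U. \<forall>\<psi>\<in>\<Sigma>\<^sub>0. sat U snd e \<psi>)) \<longrightarrow>
        (\<exists>e\<in>assignments U. \<forall>\<psi>\<in>\<Sigma>. sat U snd e \<psi>))"

text \<open>
  ``Large'' is read as \<open>|U| > |L|\<close>, where \<open>|L|\<close> is the number of \<open>L\<close>-formulas; in particular \<open>U\<close> is
  uncountable.
\<close>

definition monster ::
  "('s, 'f, 'r) lang \<Rightarrow> ('s, 'f, 'r, 'u) form set \<Rightarrow> ('s, 'f, 'r, 'u) struct \<Rightarrow> bool" where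
  "monster L T U \<longleftrightarrow>
     models L U T \<and> saturated L U \<and> small U (formulas L {} UNIV :: ('s, 'f, 'r, 'u) form set)"


subsection \<open>Partial types and implication over the elementary diagram\<close>

definition elementary_diagram ::
  "('s, 'f, 'r) lang \<Rightarrow> ('s, 'f, 'r, 'u) struct \<Rightarrow> ('s, 'f, 'r, 'u) form set" where
  "elementary_diagram L U = {\<sigma> \<in> formulas L (elements U) {}. true_in U \<sigma>}"

definition satisfies ::
  "('s, 'f, 'r, 'm) struct \<Rightarrow> (('s, 'u) param \<Rightarrow> 'm) \<Rightarrow> ('s var \<Rightarrow> 'm) \<Rightarrow>
   ('s, 'f, 'r, 'u) form set \<Rightarrow> bool" where
  "satisfies M c e \<Sigma> \<longleftrightarrow> (\<forall>\<psi>\<in>\<Sigma>. sat M c e \<psi>)"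

definition diagram_model ::
  "('s, 'f, 'r) lang \<Rightarrow> ('s, 'f, 'r, 'u) struct \<Rightarrow>
   ('s, 'f, 'r, 'u) struct \<Rightarrow> (('s, 'u) param \<Rightarrow> 'u) \<Rightarrow> bool" where
  "diagram_model L U M c \<longleftrightarrow>
     is_structure L M \<and> (\<forall>p\<in>elements U. c p \<in> univ M (fst p)) \<and>
     (\<forall>e\<in>assignments M. satisfies M c e (elementary_diagram L U))"

definition consistent ::
  "('s, 'f, 'r) lang \<Rightarrow> ('s, 'f, 'r, 'u) struct \<Rightarrow> ('s, 'f, 'r, 'u) form set \<Rightarrow> bool" where
  "consistent L U \<Sigma> \<longleftrightarrow>
     (\<exists>M c. diagram_model L U M c \<and> (\<exists>e\<in>assignments M. satisfies M c e \<Sigma>))"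

definition implies ::
  "('s, 'f, 'r) lang \<Rightarrow> ('s, 'f, 'r, 'u) struct \<Rightarrow>
   ('s, 'f, 'r, 'u) form set \<Rightarrow> ('s, 'f, 'r, 'u) form set \<Rightarrow> bool" where
  "implies L U \<Sigma> \<Gamma> \<longleftrightarrow>
     (\<forall>M c. diagram_model L U M c \<longrightarrow>
        (\<forall>e\<in>assignments M. satisfies M c e \<Sigma> \<longrightarrow> satisfies M c e \<Gamma>))"

definition partial_type ::
  "('s, 'f, 'r) lang \<Rightarrow> ('s, 'f, 'r, 'u) struct \<Rightarrow> 's var list \<Rightarrow>
   ('s, 'f, 'r, 'u) form set \<Rightarrow> bool" where
  "partial_type L U x \<pi> \<longleftrightarrow> \<pi> \<subseteq> formulas L (elements U) (set x) \<and> consistent L U \<pi>"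


subsection \<open>Substitution of parameters for variables\<close>

primrec subst_tm :: "('v \<rightharpoonup> 'p) \<Rightarrow> ('f, 'v, 'p) tm \<Rightarrow> ('f, 'v, 'p) tm" where
  "subst_tm \<rho> (Var v) = (case \<rho> v of None \<Rightarrow> Var v | Some p \<Rightarrow> Param p)"
| "subst_tm \<rho> (Param p) = Param p"
| "subst_tm \<rho> (App f ts) = App f (map (subst_tm \<rho>) ts)"

primrec subst_fm :: "('v \<rightharpoonup> 'p) \<Rightarrow> ('f, 'r, 'v, 'p) fm \<Rightarrow> ('f, 'r, 'v, 'p) fm" where
  "subst_fm \<rho> (Eq t t') = Eq (subst_tm \<rho> t) (subst_tm \<rho> t')"
| "subst_fm \<rho> (Rel r ts) = Rel r (map (subst_tm \<rho>) ts)"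
| "subst_fm \<rho> (Neg \<psi>) = Neg (subst_fm \<rho> \<psi>)"
| "subst_fm \<rho> (Conj \<psi> \<theta>) = Conj (subst_fm \<rho> \<psi>) (subst_fm \<rho> \<theta>)"
| "subst_fm \<rho> (Exi v \<psi>) = Exi v (subst_fm (\<rho>(v := None)) \<psi>)"

definition inst ::
  "'s var list \<Rightarrow> 'u list \<Rightarrow> ('s, 'f, 'r, 'u) form \<Rightarrow> ('s, 'f, 'r, 'u) form" where
  "inst y b = subst_fm (map_of (zip y (zip (map fst y) b)))"


subsection \<open>VC-dimension\<close>

definition shatters :: "'a set set \<Rightarrow> 'a set \<Rightarrow> bool" where
  "shatters F S \<longleftrightarrow> (\<forall>B\<subseteq>S. \<exists>C\<in>F. C \<inter> S = B)"

definition vc_dim :: "'a set set \<Rightarrow> enat" where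
  "vc_dim F = Sup {enat (card S) | S. finite S \<and> shatters F S}"

definition vc ::
  "('s, 'f, 'r, 'u) struct \<Rightarrow> ('s, 'f, 'r, 'u) form \<Rightarrow> 's var list \<Rightarrow> 's var list \<Rightarrow> enat" where
  "vc U \<phi> x y =
     vc_dim ((\<lambda>b. {a \<in> tuples_of_vars U x. true_in U (inst x a (inst y b \<phi>))}) ` tuples_of_vars U y)"

definition vc_dual ::
  "('s, 'f, 'r, 'u) struct \<Rightarrow> ('s, 'f, 'r, 'u) form \<Rightarrow> 's var list \<Rightarrow> 's var list \<Rightarrow> enat" where
  "vc_dual U \<phi> x y =
     vc_dim ((\<lambda>a. {b \<in> tuples_of_vars U y. true_in U (inst x a (inst y b \<phi>))}) ` tuples_of_vars U x)"

definition NIP ::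
  "('s, 'f, 'r, 'u) struct \<Rightarrow> ('s, 'f, 'r, 'u) form \<Rightarrow> 's var list \<Rightarrow> 's var list \<Rightarrow> bool" where
  "NIP U \<phi> x y \<longleftrightarrow> vc U \<phi> x y < \<infinity>"


subsection \<open>Types of a single formula, and compressibility\<close>

definition phi_literals ::
  "('s, 'f, 'r, 'u) form \<Rightarrow> 's var list \<Rightarrow> 'u list set \<Rightarrow> ('s, 'f, 'r, 'u) form set" where
  "phi_literals \<phi> y A = (\<lambda>a. inst y a \<phi>) ` A \<union> (\<lambda>a. Neg (inst y a \<phi>)) ` A"

definition phi_types ::
  "('s, 'f, 'r) lang \<Rightarrow> ('s, 'f, 'r, 'u) struct \<Rightarrow> ('s, 'f, 'r, 'u) form \<Rightarrow> 's var list \<Rightarrow>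
   'u list set \<Rightarrow> ('s, 'f, 'r, 'u) form set set" where
  "phi_types L U \<phi> y A =
     {p. p \<subseteq> phi_literals \<phi> y A \<and> consistent L U p \<and>
         (\<forall>q. p \<subseteq> q \<and> q \<subseteq> phi_literals \<phi> y A \<and> consistent L U q \<longrightarrow> q = p)}"

text \<open>The topology on \<open>S\<^sub>\<phi>(A)\<close> induced from \<open>2\<^sup>A\<close> by \<open>p \<mapsto> (a \<mapsto> [\<phi>(x,a) \<in> p])\<close>.\<close>

definition phi_type_space ::
  "('s, 'f, 'r) lang \<Rightarrow> ('s, 'f, 'r, 'u) struct \<Rightarrow> ('s, 'f, 'r, 'u) form \<Rightarrow> 's var list \<Rightarrow>
   'u list set \<Rightarrow> ('s, 'f, 'r, 'u) form set topology" where
  "phi_type_space L U \<phi> y A =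
     pullback_topology (phi_types L U \<phi> y A) (\<lambda>p. \<lambda>a\<in>A. inst y a \<phi> \<in> p)
       (product_topology (\<lambda>_. discrete_topology (UNIV :: bool set)) A)"

definition phi_types_mod ::
  "('s, 'f, 'r) lang \<Rightarrow> ('s, 'f, 'r, 'u) struct \<Rightarrow> ('s, 'f, 'r, 'u) form \<Rightarrow> 's var list \<Rightarrow>
   ('s, 'f, 'r, 'u) form set \<Rightarrow> 'u list set \<Rightarrow> ('s, 'f, 'r, 'u) form set set" where
  "phi_types_mod L U \<phi> y \<pi> A = {p \<in> phi_types L U \<phi> y A. consistent L U (p \<union> \<pi>)}"

definition type_restrict ::
  "('s, 'f, 'r, 'u) form \<Rightarrow> 's var list \<Rightarrow> ('s, 'f, 'r, 'u) form set \<Rightarrow> 'u list set \<Rightarrow>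
   ('s, 'f, 'r, 'u) form set" where
  "type_restrict \<phi> y p A\<^sub>0 = p \<inter> phi_literals \<phi> y A\<^sub>0"

definition compressible ::
  "('s, 'f, 'r) lang \<Rightarrow> ('s, 'f, 'r, 'u) struct \<Rightarrow> ('s, 'f, 'r, 'u) form \<Rightarrow> 's var list \<Rightarrow>
   ('s, 'f, 'r, 'u) form set \<Rightarrow> 'u list set \<Rightarrow> nat \<Rightarrow> ('s, 'f, 'r, 'u) form set \<Rightarrow> bool" where
  "compressible L U \<phi> y \<pi> A k p \<longleftrightarrow>
     (\<forall>A\<^sub>0\<subseteq>A. finite A\<^sub>0 \<longrightarrow>
        (\<exists>A\<^sub>1\<subseteq>A. finite A\<^sub>1 \<and> card A\<^sub>1 \<le> k \<and>
           implies L U (type_restrict \<phi> y p A\<^sub>1 \<union> \<pi>) (type_restrict \<phi> y p A\<^sub>0)))"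

definition compressible_types ::
  "('s, 'f, 'r) lang \<Rightarrow> ('s, 'f, 'r, 'u) struct \<Rightarrow> ('s, 'f, 'r, 'u) form \<Rightarrow> 's var list \<Rightarrow>
   ('s, 'f, 'r, 'u) form set \<Rightarrow> nat \<Rightarrow> 'u list set \<Rightarrow> ('s, 'f, 'r, 'u) form set set" where
  "compressible_types L U \<phi> y \<pi> k A =
     {p \<in> phi_types_mod L U \<phi> y \<pi> A. compressible L U \<phi> y \<pi> A k p}"

definition compressible_types_star ::
  "('s, 'f, 'r) lang \<Rightarrow> ('s, 'f, 'r, 'u) struct \<Rightarrow> ('s, 'f, 'r, 'u) form \<Rightarrow> 's var list \<Rightarrow>
   ('s, 'f, 'r, 'u) form set \<Rightarrow> 'u list set \<Rightarrow> ('s, 'f, 'r, 'u) form set set" where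
  "compressible_types_star L U \<phi> y \<pi> A = (\<Union>k. compressible_types L U \<phi> y \<pi> k A)"

text \<open>Computed in the integers because of the term \<open>d - 2\<close>; the value is never negative.\<close>

definition k_comp :: "nat \<Rightarrow> nat" where
  "k_comp d = nat (2 ^ (d + 1) * (int d - 2) + int d + 4)"

end

theory Submission
  imports Defs
begin

text \<open>
  By saturation the \<open>\<phi>\<close>-types over \<open>A\<close> consistent with \<open>\<pi>\<close> are the traces on \<open>A\<close> of the realisations
  of \<open>\<pi>\<close> in \<open>U\<close>, and these form a compact set system of VC-dimension at most \<open>d\<close>. In such a
  system \<open>X\<close> a compressible point is found by transferring the Chen--Cheng--Tang bound on minimum
  teaching dimension from finite classes: where they choose a smallest nonempty set of concepts
  cut out by \<open>2\<^sup>d(d-1)+1\<close> literals, take by Zorn's lemma a maximal consistent partial type \<open>q\<close> each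
  finite part of which follows from at most that many of its literals. If the points satisfying
  \<open>q\<close> still shattered a set \<open>S\<close> of \<open>d\<close> elements, then, since \<open>X\<close> shatters no set of \<open>d+1\<close>
  elements, each literal of \<open>q\<close> would follow from one of the \<open>2\<^sup>d\<close> complete types over \<open>S\<close>, so that
  by the pigeonhole principle one of these could replace \<open>d\<close> literals of every large enough finite
  part of \<open>q\<close> and be added to \<open>q\<close>. So the VC-dimension drops, and induction on \<open>d\<close> gives (i) with
  \<open>k_comp d = k_comp (d-1) + 2\<^sup>d(d-1) + 1\<close>. Statement (ii) is (i) applied to the points extending \<open>p'\<close>,
  and (iii) is (ii) applied to finite \<open>A'\<close>.
\<close>

section \<open>Compressible partial types in compact set systems\<close>

text \<open>A literal \<open>(b, v)\<close> asserts that \<open>b \<in> P\<close> has truth value \<open>v\<close>; a set of literals is a partial type.\<close>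

definition Mod :: "'b set set \<Rightarrow> ('b \<times> bool) set \<Rightarrow> 'b set set" where
  "Mod X q = {P \<in> X. \<forall>(b, v)\<in>q. (b \<in> P) = v}"

text \<open>The complete type of the point \<open>P\<close> over \<open>A\<close>.\<close>

definition lits :: "'b set \<Rightarrow> 'b set \<Rightarrow> ('b \<times> bool) set" where
  "lits A P = (\<lambda>b. (b, b \<in> P)) ` A"

text \<open>Equivalently, the restrictions to \<open>A\<close> of the members of \<open>X\<close>
  form a closed subset of \<open>2^A\<close>, with the literals as subbasic clopen sets.\<close>

definition compact_on :: "'b set \<Rightarrow> 'b set set \<Rightarrow> bool" where
  "compact_on A X \<longleftrightarrow>
     (\<forall>q\<subseteq>A \<times> UNIV. (\<forall>r\<subseteq>q. finite r \<longrightarrow> Mod X r \<noteq> {}) \<longrightarrow> Mod X q \<noteq> {})"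

definition compr :: "'b set set \<Rightarrow> nat \<Rightarrow> ('b \<times> bool) set \<Rightarrow> bool" where
  "compr X k q \<longleftrightarrow>
     (\<forall>r\<subseteq>q. finite r \<longrightarrow> (\<exists>s\<subseteq>q. finite s \<and> card s \<le> k \<and> Mod X s \<subseteq> Mod X r))"

definition vc_on_le :: "'b set \<Rightarrow> 'b set set \<Rightarrow> nat \<Rightarrow> bool" where
  "vc_on_le A X d \<longleftrightarrow> (\<forall>S\<subseteq>A. finite S \<longrightarrow> shatters X S \<longrightarrow> card S \<le> d)"

lemma Mod_empty [simp]: "Mod X {} = X"
  by (simp add: Mod_def)

lemma Mod_Un: "Mod X (q \<union> r) = Mod X q \<inter> Mod X r"
  by (auto simp: Mod_def)

lemma Mod_Mod: "Mod (Mod X q) r = Mod X (q \<union> r)"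
  by (auto simp: Mod_def)

lemma Mod_subset: "Mod X q \<subseteq> X"
  by (auto simp: Mod_def)

lemma Mod_antimono: "r \<subseteq> q \<Longrightarrow> Mod X q \<subseteq> Mod X r"
  by (auto simp: Mod_def)

lemma lits_subset: "B \<subseteq> A \<Longrightarrow> lits B P \<subseteq> lits A P"
  by (auto simp: lits_def)

lemma lits_subset_times: "lits A P \<subseteq> A \<times> UNIV"
  by (auto simp: lits_def)

lemma Mod_lits: "Mod X (lits B P) = {Q \<in> X. Q \<inter> B = P \<inter> B}"
  by (auto simp: Mod_def lits_def)

lemma lits_if_Mod: "P \<in> Mod X q \<Longrightarrow> q \<subseteq> A \<times> UNIV \<Longrightarrow> q \<subseteq> lits A P"
  by (fastforce simp: Mod_def lits_def)

lemma shatters_mono: "X \<subseteq> Y \<Longrightarrow> shatters X S \<Longrightarrow> shatters Y S"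
  unfolding shatters_def by (meson subsetD)

lemma comprE:
  assumes "compr X k q" "r \<subseteq> q" "finite r"
  obtains s where "s \<subseteq> q" "finite s" "card s \<le> k" "Mod X s \<subseteq> Mod X r"
  using assms unfolding compr_def by metis

lemma vc_on_le_mono: "vc_on_le A X d \<Longrightarrow> Y \<subseteq> X \<Longrightarrow> vc_on_le A Y d"
  unfolding vc_on_le_def using shatters_mono by blast

section \<open>Compactness and composition of compressions\<close>

lemma compact_onD:
  assumes "compact_on A X" "q \<subseteq> A \<times> UNIV" "\<And>r. r \<subseteq> q \<Longrightarrow> finite r \<Longrightarrow> Mod X r \<noteq> {}"
  shows "Mod X q \<noteq> {}"
  using assms unfolding compact_on_def by simp

text \<open>The literals \<open>l\<close> of \<open>r\<close> are handled in turn: \<open>q\<close>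
  with the negation of \<open>l\<close> has no model, hence neither has some finite
  \<open>s\<close>, and what \<open>s\<close> takes from \<open>q\<close> implies
  \<open>l\<close>.\<close>

lemma compact_on_finite_subset:
  assumes c: "compact_on A X" and q: "q \<subseteq> A \<times> UNIV"
    and fin: "finite r" and r: "r \<subseteq> A \<times> UNIV" and le: "Mod X q \<subseteq> Mod X r"
  shows "\<exists>q0\<subseteq>q. finite q0 \<and> Mod X q0 \<subseteq> Mod X r"
  using fin r le
proof (induction r)
  case empty
  then show ?case by (intro exI[of _ "{}"]) simp
next
  case (insert l r)
  obtain b v where l: "l = (b, v)" by force
  have "Mod X (insert (b, \<not> v) q) = {}"
    using insert.prems(2) unfolding Mod_def l by auto
  then obtain s where s: "s \<subseteq> insert (b, \<not> v) q" "finite s" "Mod X s = {}"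
    using compact_onD[OF c, of "insert (b, \<not> v) q"] insert.prems(1) q l by auto
  have "Mod X (insert l r) \<subseteq> Mod X r" by (rule Mod_antimono) blast
  then obtain q0 where q0: "q0 \<subseteq> q" "finite q0" "Mod X q0 \<subseteq> Mod X r"
    using insert.IH insert.prems by auto
  have "Mod X (q0 \<union> (s - {(b, \<not> v)})) \<subseteq> Mod X (insert l r)"
  proof
    fix P assume P: "P \<in> Mod X (q0 \<union> (s - {(b, \<not> v)}))"
    have "(b \<in> P) = v"
    proof (rule ccontr)
      assume "(b \<in> P) \<noteq> v"
      with P have "P \<in> Mod X s" by (auto simp: Mod_def)
      with s(3) show False by simp
    qed
    moreover have "P \<in> Mod X r" using P q0(3) by (auto simp: Mod_Un)
    ultimately show "P \<in> Mod X (insert l r)" by (auto simp: Mod_def l)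
  qed
  then show ?case using s q0 by (intro exI[of _ "q0 \<union> (s - {(b, \<not> v)})"]) auto
qed

lemma compact_on_Mod:
  assumes c: "compact_on A X" and q: "q \<subseteq> A \<times> UNIV"
  shows "compact_on A (Mod X q)"
  unfolding compact_on_def
proof (intro allI impI)
  fix q' assume q': "q' \<subseteq> A \<times> UNIV" and fs: "\<forall>r\<subseteq>q'. finite r \<longrightarrow> Mod (Mod X q) r \<noteq> {}"
  have "Mod X r \<noteq> {}" if "r \<subseteq> q \<union> q'" "finite r" for r
  proof -
    have "Mod (Mod X q) (r \<inter> q') \<noteq> {}" using fs that by simp
    moreover have "Mod (Mod X q) (r \<inter> q') \<subseteq> Mod X r"
      unfolding Mod_Mod by (rule Mod_antimono) (use that in blast)
    ultimately show ?thesis by blast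
  qed
  then show "Mod (Mod X q) q' \<noteq> {}"
    unfolding Mod_Mod using compact_onD[OF c] q q' by simp
qed

text \<open>Modulo \<open>q\<close>, at most \<open>k\<close> literals \<open>s\<close> of the type
  of \<open>P\<close> suffice for \<open>r\<close>; this uses only a finite part of
  \<open>q\<close>, which in turn follows from at most \<open>l\<close> literals of
  \<open>q\<close>.\<close>

lemma compr_trans:
  assumes c: "compact_on A X" and q: "q \<subseteq> A \<times> UNIV" and P: "P \<in> Mod X q"
    and cq: "compr X l q" and cP: "compr (Mod X q) k (lits A P)"
  shows "compr X (l + k) (lits A P)"
  unfolding compr_def
proof (intro allI impI)
  fix r assume r: "r \<subseteq> lits A P" "finite r"
  obtain s where s: "s \<subseteq> lits A P" "finite s" "card s \<le> k" "Mod (Mod X q) s \<subseteq> Mod (Mod X q) r"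
    using comprE[OF cP r] .
  have rA: "r \<subseteq> A \<times> UNIV" and sA: "s \<subseteq> A \<times> UNIV"
    using r(1) s(1) lits_subset_times[of A P] by auto
  have "Mod (Mod X s) q \<subseteq> Mod (Mod X s) r"
    using s(4) by (auto simp: Mod_Mod Mod_Un)
  \<comment> \<open>Compactness is used in \<open>Mod X s\<close>, so that the finite part is drawn
    from \<open>q\<close> alone and \<open>s\<close> does not grow.\<close>
  then obtain q0 where q0: "q0 \<subseteq> q" "finite q0" "Mod (Mod X s) q0 \<subseteq> Mod (Mod X s) r"
    using compact_on_finite_subset[OF compact_on_Mod[OF c sA] q r(2) rA] by metis
  obtain t where t: "t \<subseteq> q" "finite t" "card t \<le> l" "Mod X t \<subseteq> Mod X q0"
    using comprE[OF cq q0(1,2)] .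
  have "Mod X (t \<union> s) \<subseteq> Mod X r"
    using t(4) q0(3) by (auto simp: Mod_Mod Mod_Un)
  moreover have "card (t \<union> s) \<le> l + k"
    using t(3) s(3) card_Un_le[of t s] by linarith
  moreover have "t \<union> s \<subseteq> lits A P"
    using t(1) s(1) lits_if_Mod[OF P q] by blast
  ultimately show "\<exists>s\<subseteq>lits A P. finite s \<and> card s \<le> l + k \<and> Mod X s \<subseteq> Mod X r"
    using s(2) t(2) by (intro exI[of _ "t \<union> s"]) auto
qed

section \<open>Maximal compressible partial types and the drop in VC-dimension\<close>

text \<open>Both conditions pass to unions of chains because a finite subset of the union lies in
  one member: it is compressed there and has a model there, and compactness then gives a model of
  the whole union.\<close>

lemma exists_maximal_compr:
  assumes c: "compact_on A X" and ne: "X \<noteq> {}"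
  obtains q where "q \<subseteq> A \<times> UNIV" "compr X k q" "Mod X q \<noteq> {}"
    "\<And>q'. q \<subseteq> q' \<Longrightarrow> q' \<subseteq> A \<times> UNIV \<Longrightarrow> compr X k q' \<Longrightarrow> Mod X q' \<noteq> {} \<Longrightarrow> q' = q"
proof -
  let ?Q = "{q. q \<subseteq> A \<times> UNIV \<and> compr X k q \<and> Mod X q \<noteq> {}}"
  have "\<exists>q\<in>?Q. \<forall>q'\<in>?Q. q \<subseteq> q' \<longrightarrow> q' = q"
  proof (rule subset_Zorn_nonempty)
    have "compr X k {}" by (auto simp: compr_def)
    then show "?Q \<noteq> {}" using ne by (auto intro!: exI[of _ "{}"])
  next
    fix \<C> assume "\<C> \<noteq> {}" and ch: "subset.chain ?Q \<C>"
    then have sub: "\<C> \<subseteq> ?Q" by (simp add: subset.chain_def)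
    have cover: "\<exists>q\<in>\<C>. r \<subseteq> q" if "finite r" "r \<subseteq> \<Union>\<C>" for r
      using finite_subset_Union_chain[OF that \<open>\<C> \<noteq> {}\<close> ch] by blast
    have "\<Union>\<C> \<subseteq> A \<times> UNIV" using sub by blast
    moreover have "compr X k (\<Union>\<C>)"
      unfolding compr_def
    proof (intro allI impI)
      fix r assume "r \<subseteq> \<Union>\<C>" "finite r"
      then obtain q where q: "q \<in> \<C>" "r \<subseteq> q" using cover by blast
      have "compr X k q" using q(1) sub by blast
      then obtain s where "s \<subseteq> q" "finite s" "card s \<le> k" "Mod X s \<subseteq> Mod X r"
        using comprE q(2) \<open>finite r\<close> by metis
      then show "\<exists>s\<subseteq>\<Union>\<C>. finite s \<and> card s \<le> k \<and> Mod X s \<subseteq> Mod X r"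
        using q(1) by blast
    qed
    moreover have "Mod X (\<Union>\<C>) \<noteq> {}"
    proof -
      have fs: "Mod X r \<noteq> {}" if r: "r \<subseteq> \<Union>\<C>" "finite r" for r
      proof -
        obtain q where q: "q \<in> \<C>" "r \<subseteq> q" using cover[OF r(2,1)] by blast
        then have "Mod X q \<noteq> {}" using sub by blast
        with Mod_antimono[OF q(2)] show ?thesis by blast
      qed
      show ?thesis by (rule compact_onD[OF c \<open>\<Union>\<C> \<subseteq> A \<times> UNIV\<close> fs])
    qed
    ultimately show "\<Union>\<C> \<in> ?Q" by simp
  qed
  then obtain q where q: "q \<in> ?Q" and max: "\<forall>q'\<in>?Q. q \<subseteq> q' \<longrightarrow> q' = q"
    by (rule bexE)
  show thesis
  proof (rule that[of q])
    show "q' = q" if "q \<subseteq> q'" "q' \<subseteq> A \<times> UNIV" "compr X k q'" "Mod X q' \<noteq> {}" for q'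
      by (rule max[rule_format]) (simp_all add: that)
  qed (use q in simp_all)
qed

text \<open>A shattered \<open>S\<close> to be excluded has \<open>Suc d\<close> elements, hence
  \<open>2 ^ Suc d\<close> complete types. A type over \<open>S\<close> has \<open>Suc d\<close>
  literals, so trading at least as many literals of \<open>q\<close> for it costs nothing. The
  \<open>d\<close> of the overview is \<open>Suc d\<close> here.\<close>

lemma exists_compr_vc_drop:
  assumes c: "compact_on A X" and ne: "X \<noteq> {}" and vc: "vc_on_le A X (Suc d)"
  obtains q where "q \<subseteq> A \<times> UNIV" "compr X (2 ^ Suc d * d + 1) q" "Mod X q \<noteq> {}"
    "vc_on_le A (Mod X q) d"
proof -
  define k :: nat where "k = 2 ^ Suc d * d + 1"
  obtain q where q: "q \<subseteq> A \<times> UNIV" "compr X k q" "Mod X q \<noteq> {}"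
    and max: "\<And>q'. q \<subseteq> q' \<Longrightarrow> q' \<subseteq> A \<times> UNIV \<Longrightarrow> compr X k q' \<Longrightarrow> Mod X q' \<noteq> {} \<Longrightarrow> q' = q"
    using exists_maximal_compr[OF c ne] by metis
  have "card S \<le> d" if S: "S \<subseteq> A" "finite S" "shatters (Mod X q) S" for S
  proof (rule ccontr)
    assume "\<not> card S \<le> d"
    moreover have "card S \<le> Suc d"
      using vc S(1,2) shatters_mono[OF Mod_subset S(3)] unfolding vc_on_le_def by metis
    ultimately have cS: "card S = Suc d" by simp
    have shat: "\<exists>P\<in>Mod X q. P \<inter> S = B" if "B \<subseteq> S" for B
      using S(3) that unfolding shatters_def by metis
    \<comment> \<open>Shattering by models of \<open>q\<close> realises both truth values at each
      point of \<open>S\<close>, so \<open>q\<close> decides none of them; \<open>B\<close> forces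
      the value opposite to \<open>v\<close>.\<close>
    have disj: "b \<notin> S" if "(b, v) \<in> q" for b v
    proof
      assume "b \<in> S"
      define B where "B = (if v then {} else {b})"
      have "B \<subseteq> S" using \<open>b \<in> S\<close> by (simp add: B_def)
      from shat[OF this] obtain P where "P \<in> Mod X q" "P \<inter> S = B" by (rule bexE)
      then show False using that \<open>b \<in> S\<close> by (auto simp: Mod_def B_def split: if_splits)
    qed
    obtain b0 where b0: "b0 \<in> S" using cS by fastforce
    obtain P0 where P0: "P0 \<in> Mod X q" using q(3) by blast
    \<comment> \<open>Fewer than \<open>k\<close> literals would leave room for one more, true of
      \<open>P0\<close> at the undecided \<open>b0\<close>: the enlarged set compresses itself,
      against maximality.\<close>
    have large: "\<not> (finite q \<and> card q < k)"
    proof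
      assume fin: "finite q \<and> card q < k"
      let ?q = "insert (b0, b0 \<in> P0) q"
      have "compr X k ?q"
        unfolding compr_def
      proof (intro allI impI)
        fix r assume "r \<subseteq> ?q"
        then show "\<exists>s\<subseteq>?q. finite s \<and> card s \<le> k \<and> Mod X s \<subseteq> Mod X r"
          using fin Mod_antimono[of r ?q]
          by (intro exI[of _ ?q]) (auto simp: card_insert_if)
      qed
      moreover have "P0 \<in> Mod X ?q" using P0 by (auto simp: Mod_def)
      moreover have "?q \<subseteq> A \<times> UNIV" using q(1) b0 S(1) by auto
      ultimately have "?q = q" by (intro max) auto
      then show False using disj b0 by blast
    qed
    \<comment> \<open>Compressing sets are padded to exactly \<open>k\<close> literals of
      \<open>q\<close>, so that the pigeonhole count applies.\<close>
    have extend: "\<exists>t. s \<subseteq> t \<and> t \<subseteq> q \<and> finite t \<and> card t = k"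
      if s: "s \<subseteq> q" "finite s" "card s \<le> k" for s
    proof -
      obtain w where w: "w \<subseteq> q" "finite w" "card w = k"
      proof (cases "finite q")
        case True
        with large have "k \<le> card q" by simp
        then show thesis using obtain_subset_with_card_n that by metis
      next
        case False
        then show thesis using infinite_arbitrarily_large that by metis
      qed
      have "k \<le> card (s \<union> w)" using w s(2) by (metis card_mono finite_Un sup.cobounded2)
      then obtain t where t: "s \<subseteq> t" "t \<subseteq> s \<union> w" "card t = k"
        using exists_subset_between[of s k "s \<union> w"] s w(2) by auto
      then have "finite t" "t \<subseteq> q"
        using finite_subset[OF t(2)] s(1,2) w(1,2) by auto
      with t show ?thesis by (intro exI[of _ t]) simp
    qed
    \<comment> \<open>Otherwise \<open>insert b S\<close>, of size \<open>d + 2\<close>, is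
      shattered by \<open>X\<close>: over every trace on \<open>S\<close>, the value
      \<open>v\<close> at \<open>b\<close> comes from the models of \<open>q\<close> and the
      opposite value from the failed implication.\<close>
    have "\<exists>B\<subseteq>S. Mod X (lits S B) \<subseteq> Mod X {l}" if l: "l \<in> q" for l
    proof (rule ccontr)
      assume neg: "\<not> (\<exists>B\<subseteq>S. Mod X (lits S B) \<subseteq> Mod X {l})"
      obtain b v where bv: "l = (b, v)" by force
      have "b \<in> A" "b \<notin> S" using l q(1) disj bv by auto
      have "shatters X (insert b S)"
        unfolding shatters_def
      proof (intro allI impI)
        fix B' assume B': "B' \<subseteq> insert b S"
        show "\<exists>P\<in>X. P \<inter> insert b S = B'"
        proof (cases "(b \<in> B') = v")
          case True
          obtain P where P: "P \<in> Mod X q" "P \<inter> S = B' \<inter> S" using shat[of "B' \<inter> S"] by blast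
          then have "(b \<in> P) = v" using l unfolding bv Mod_def by blast
          then have "P \<inter> insert b S = B'" using P True B' by blast
          moreover have "P \<in> X" using P(1) by (simp add: Mod_def)
          ultimately show ?thesis by (intro bexI[of _ P])
        next
          case False
          have "\<not> Mod X (lits S (B' \<inter> S)) \<subseteq> Mod X {l}" using neg by simp
          then obtain P where P: "P \<in> Mod X (lits S (B' \<inter> S))" "P \<notin> Mod X {l}"
            by (auto simp: subset_iff)
          from P(1) have "P \<in> X" "P \<inter> S = B' \<inter> S" unfolding Mod_lits by auto
          moreover from this P(2) have "(b \<in> P) \<noteq> v" by (simp add: bv Mod_def)
          ultimately have "P \<inter> insert b S = B'" using False B' by blast
          then show ?thesis using \<open>P \<in> X\<close> by (intro bexI[of _ P])
        qed
      qed
      then have "card (insert b S) \<le> Suc d"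
        using vc S(1,2) \<open>b \<in> A\<close> unfolding vc_on_le_def by simp
      then show False using cS \<open>b \<notin> S\<close> S(2) by simp
    qed
    then have "\<forall>l\<in>q. \<exists>B. B \<subseteq> S \<and> Mod X (lits S B) \<subseteq> Mod X {l}" by simp
    from bchoice[OF this] obtain \<sigma> where \<sigma>: "\<And>l. l \<in> q \<Longrightarrow> \<sigma> l \<subseteq> S \<and> Mod X (lits S (\<sigma> l)) \<subseteq> Mod X {l}"
      by blast
    \<comment> \<open>By shattering, \<open>q \<union> lits S B\<close> has a model, and it properly
      extends \<open>q\<close>; maximality therefore supplies a finite part that resists compression
      to \<open>k\<close> literals.\<close>
    have "\<exists>r\<subseteq>q \<union> lits S B. finite r \<and>
        \<not> (\<exists>s\<subseteq>q \<union> lits S B. finite s \<and> card s \<le> k \<and> Mod X s \<subseteq> Mod X r)" if B: "B \<subseteq> S" for B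
    proof -
      obtain P where "P \<in> Mod X q" "P \<inter> S = B" using shat[OF B] by blast
      with B have "P \<in> Mod X (q \<union> lits S B)"
        using subsetD[OF Mod_subset] unfolding Mod_Un Mod_lits by auto
      moreover have "q \<union> lits S B \<noteq> q" using b0 disj by (auto simp: lits_def)
      moreover have "q \<union> lits S B \<subseteq> A \<times> UNIV"
        using q(1) lits_subset_times[of S B] S(1) by blast
      ultimately have "\<not> compr X k (q \<union> lits S B)" using max[of "q \<union> lits S B"] by auto
      then show ?thesis unfolding compr_def by simp
    qed
    then have "\<forall>B\<in>Pow S. \<exists>r. r \<subseteq> q \<union> lits S B \<and> finite r \<and>
        \<not> (\<exists>s\<subseteq>q \<union> lits S B. finite s \<and> card s \<le> k \<and> Mod X s \<subseteq> Mod X r)"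
      by (simp only: Pow_iff Ball_def) simp
    from bchoice[OF this] obtain \<rho>
      where \<rho>: "\<forall>B\<in>Pow S. \<rho> B \<subseteq> q \<union> lits S B \<and> finite (\<rho> B) \<and>
        \<not> (\<exists>s\<subseteq>q \<union> lits S B. finite s \<and> card s \<le> k \<and> Mod X s \<subseteq> Mod X (\<rho> B))" ..
    \<comment> \<open>\<open>B\<close> is found only after \<open>t\<close> has been chosen, so
      \<open>t\<close> must serve every candidate: \<open>r\<close> collects the parts in
      \<open>q\<close> of all the resisting sets \<open>\<rho> B\<close>, a finite set since
      \<open>S\<close> is finite.\<close>
    define r where "r = (\<Union>B\<in>Pow S. \<rho> B) \<inter> q"
    have "r \<subseteq> q" "finite r" using \<rho> S(2) by (auto simp: r_def)
    from comprE[OF q(2) this] obtain s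
      where s: "s \<subseteq> q" "finite s" "card s \<le> k" "Mod X s \<subseteq> Mod X r" .
    then obtain t where t: "s \<subseteq> t" "t \<subseteq> q" "finite t" "card t = k" using extend by blast
    define F where "F B = \<sigma> -` {B} \<inter> t" for B
    have "\<sigma> \<in> t \<rightarrow> Pow S" using \<sigma> t(2) by blast
    then obtain B where "B \<in> Pow S" "card t \<le> card (F B) * card (Pow S)"
      using pigeonhole_card[of \<sigma> t "Pow S"] t(3) S(2) unfolding F_def by blast
    then have B: "B \<subseteq> S" and le: "card t \<le> card (F B) * 2 ^ Suc d"
      using cS S(2) by (auto simp: card_Pow)
    \<comment> \<open>Fibres of size at most \<open>d\<close> over the \<open>2 ^ Suc d\<close>
      types would cover at most \<open>k - 1\<close> literals; this fixes the constant
      \<open>k\<close>.\<close>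
    have large_fibre: "Suc d \<le> card (F B)"
    proof (rule ccontr)
      assume "\<not> Suc d \<le> card (F B)"
      then have "card (F B) * 2 ^ Suc d \<le> d * 2 ^ Suc d" by (intro mult_right_mono) auto
      with le t(4) show False by (simp add: k_def mult.commute del: power_Suc)
    qed
    txt \<open>The exchange: \<open>lits S B\<close> implies the at least \<open>d + 1\<close> literals of \<open>F B\<close> and replaces them.\<close>
    define u where "u = (t - F B) \<union> lits S B"
    have "u \<subseteq> q \<union> lits S B" "finite u"
      using t S(2) by (auto simp: u_def lits_def)
    moreover have "card u \<le> k"
    proof -
      have F: "F B \<subseteq> t" "finite (F B)" using t(3) by (auto simp: F_def)
      have "card (lits S B) \<le> Suc d" unfolding lits_def using card_image_le[OF S(2)] cS by metis
      moreover have "card (t - F B) = k - card (F B)" using F t by (simp add: card_Diff_subset)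
      moreover have "card (F B) \<le> k" using card_mono[OF t(3) F(1)] t(4) by simp
      ultimately show ?thesis using large_fibre card_Un_le[of "t - F B" "lits S B"] by (simp add: u_def)
    qed
    moreover have "Mod X u \<subseteq> Mod X (\<rho> B)"
    proof -
      have "Mod X (lits S B) \<subseteq> Mod X (F B)"
      proof -
        have "Mod X (lits S B) \<subseteq> Mod X {l}" if "l \<in> F B" for l
          using \<sigma>[of l] that t(2) by (auto simp: F_def)
        then show ?thesis using Mod_subset[of X "lits S B"] by (fastforce simp: Mod_def)
      qed
      then have "Mod X u \<subseteq> Mod X ((t - F B) \<union> F B) \<inter> Mod X (lits S B)"
        unfolding u_def Mod_Un by auto
      also have "(t - F B) \<union> F B = t" by (auto simp: F_def)
      also have "Mod X t \<inter> Mod X (lits S B) \<subseteq> Mod X (r \<union> lits S B)"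
        using Mod_antimono[OF t(1)] s(4) by (auto simp: Mod_Un)
      \<comment> \<open>The literals of \<open>\<rho> B\<close> outside \<open>r\<close> lie in
        \<open>lits S B\<close>.\<close>
      also have "\<dots> \<subseteq> Mod X (\<rho> B)"
        by (rule Mod_antimono) (use bspec[OF \<rho>, of B] B in \<open>auto simp: r_def\<close>)
      finally show ?thesis .
    qed
    ultimately have "\<exists>s\<subseteq>q \<union> lits S B. finite s \<and> card s \<le> k \<and> Mod X s \<subseteq> Mod X (\<rho> B)"
      by (intro exI[of _ u]) simp
    then show False using bspec[OF \<rho>, of B] B by simp
  qed
  then have "vc_on_le A (Mod X q) d" unfolding vc_on_le_def by simp
  with q show thesis unfolding k_def by (rule that)
qed

section \<open>The constant and the compressible points\<close>

lemma k_comp_0: "k_comp 0 = 0"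
  by (simp add: k_comp_def)

text \<open>The recursion matching the induction on \<open>d\<close>: one drop costs
  \<open>2 ^ Suc d * d + 1\<close> and the rest \<open>k_comp d\<close>. Nonnegativity of the
  integer formula, itself obtained from the recursion, makes \<open>nat\<close> additive
  here.\<close>

lemma k_comp_Suc: "k_comp (Suc d) = 2 ^ Suc d * d + 1 + k_comp d"
proof -
  define g where "g d = 2 ^ (d + 1) * (int d - 2) + int d + 4" for d
  have step: "g (Suc n) = int (2 ^ Suc n * n + 1) + g n" for n
    by (simp add: g_def algebra_simps)
  have nonneg: "g n \<ge> 0" for n
  proof (induction n)
    case 0
    then show ?case by (simp add: g_def)
  next
    case (Suc n)
    then show ?case unfolding step by linarith
  qed
  have "k_comp n = nat (g n)" for n by (simp add: k_comp_def g_def)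
  then show ?thesis using step[of d] nonneg[of d] by (simp only: nat_add_distrib of_nat_0_le_iff nat_int)
qed

text \<open>Induction on the VC bound: pass to the models of a partial type that lowers it, and add
  the two numbers of literals by \<open>compr_trans\<close>.\<close>

lemma exists_compr_point:
  assumes "compact_on A X" "X \<noteq> {}" "vc_on_le A X d"
  shows "\<exists>P\<in>X. compr X (k_comp d) (lits A P)"
  using assms
proof (induction d arbitrary: X)
  case 0
  then obtain P where P: "P \<in> X" by blast
  \<comment> \<open>A point of \<open>A\<close> at which two members differ is a shattered
    singleton, so with bound 0 all members agree on \<open>A\<close> and the empty set
    compresses.\<close>
  have "Q \<inter> A = P \<inter> A" if Q: "Q \<in> X" for Q
  proof (rule ccontr)
    assume "Q \<inter> A \<noteq> P \<inter> A"
    then obtain b where b: "b \<in> A" "(b \<in> Q) \<noteq> (b \<in> P)" by blast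
    have "shatters X {b}"
      unfolding shatters_def using P Q b by (metis Int_insert_right inf_bot_right subset_singletonD)
    then have "card {b} \<le> 0" using 0(3) b(1) unfolding vc_on_le_def by blast
    then show False by simp
  qed
  then have "Mod X (lits A P) = X" by (auto simp: Mod_lits)
  then have "Mod X r = X" if "r \<subseteq> lits A P" for r
    using Mod_antimono[OF that, of X] Mod_subset[of X r] by blast
  then have "compr X 0 (lits A P)"
    unfolding compr_def by (intro allI impI exI[of _ "{}"]) simp
  then show ?case using P by (auto simp: k_comp_0)
next
  case (Suc d)
  obtain q where q: "q \<subseteq> A \<times> UNIV" "compr X (2 ^ Suc d * d + 1) q" "Mod X q \<noteq> {}"
    "vc_on_le A (Mod X q) d"
    using exists_compr_vc_drop[OF Suc.prems] .
  then obtain P where P: "P \<in> Mod X q" "compr (Mod X q) (k_comp d) (lits A P)"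
    using Suc.IH compact_on_Mod Suc.prems(1) by metis
  show ?case
    unfolding k_comp_Suc using compr_trans[OF Suc.prems(1) q(1) P(1) q(2) P(2)]
      subsetD[OF Mod_subset P(1)] by (intro bexI[of _ P])
qed

text \<open>The members agreeing with \<open>Q\<close> on \<open>B\<close> again form a compact
  system with VC bound \<open>d\<close>; a compressible point there is compressible in
  \<open>X\<close> too, at the extra cost \<open>l\<close> of \<open>lits B Q\<close>.\<close>

lemma compr_extend:
  assumes c: "compact_on A X" and vc: "vc_on_le A X d" and B: "B \<subseteq> A" and Q: "Q \<in> X"
    and cQ: "compr X l (lits B Q)"
  shows "\<exists>P\<in>X. P \<inter> B = Q \<inter> B \<and> compr X (l + k_comp d) (lits A P)"
proof -
  have q: "lits B Q \<subseteq> A \<times> UNIV" using lits_subset_times B by blast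
  have "Q \<in> Mod X (lits B Q)" using Q by (simp add: Mod_lits)
  then obtain P where P: "P \<in> Mod X (lits B Q)" "compr (Mod X (lits B Q)) (k_comp d) (lits A P)"
    using exists_compr_point[OF compact_on_Mod[OF c q] _ vc_on_le_mono[OF vc Mod_subset]] by blast
  with compr_trans[OF c q P(1) cQ P(2)] show ?thesis by (auto simp: Mod_lits)
qed

section \<open>Satisfaction and substitution\<close>

definition subst_env :: "('p \<Rightarrow> 'm) \<Rightarrow> ('v \<rightharpoonup> 'p) \<Rightarrow> ('v \<Rightarrow> 'm) \<Rightarrow> 'v \<Rightarrow> 'm" where
  "subst_env c \<rho> e = (\<lambda>v. case \<rho> v of None \<Rightarrow> e v | Some p \<Rightarrow> c p)"

definition sort_preserving :: "('s var \<rightharpoonup> ('s, 'u) param) \<Rightarrow> bool" where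
  "sort_preserving \<rho> \<longleftrightarrow> (\<forall>v p. \<rho> v = Some p \<longrightarrow> fst p = fst v)"

lemma eval_cong: "(\<And>v. v \<in> tm_vars t \<Longrightarrow> e v = e' v) \<Longrightarrow> eval M c e t = eval M c e' t"
proof (induction t)
  case (App f ts)
  then have "map (eval M c e) ts = map (eval M c e') ts" by auto
  then show ?case by (metis eval.simps(3))
qed auto

lemma sat_cong:
  fixes M :: "('s, 'f, 'r, 'm) struct"
  shows "(\<And>v. v \<in> fv \<psi> \<Longrightarrow> e v = e' v) \<Longrightarrow> sat M c e \<psi> \<longleftrightarrow> sat M c e' \<psi>"
proof (induction \<psi> arbitrary: e e')
  case (Eq t t')
  then have "eval M c e t = eval M c e' t" "eval M c e t' = eval M c e' t'"
    by (auto intro: eval_cong)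
  then show ?case by simp
next
  case (Rel r ts)
  have "eval M c e t = eval M c e' t" if "t \<in> set ts" for t
    using Rel that by (intro eval_cong) auto
  then have "map (eval M c e) ts = map (eval M c e') ts" by simp
  then show ?case by (metis sat.simps(2))
next
  case (Exi v \<psi>)
  have "sat M c (e(v := a)) \<psi> \<longleftrightarrow> sat M c (e'(v := a)) \<psi>" for a
    using Exi.prems by (intro Exi.IH) auto
  then show ?case by simp
next
  case (Neg \<psi>)
  show ?case using Neg.IH[OF Neg.prems] by simp
next
  case (Conj \<psi> \<theta>)
  show ?case using Conj.IH(1)[OF Conj.prems] Conj.IH(2)[OF Conj.prems] by simp
qed

lemma eval_subst_tm: "eval M c e (subst_tm \<rho> t) = eval M c (subst_env c \<rho> e) t"
proof (induction t)
  case (App f ts)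
  then have "map (eval M c e \<circ> subst_tm \<rho>) ts = map (eval M c (subst_env c \<rho> e)) ts" by simp
  then show ?case by (simp only: subst_tm.simps eval.simps map_map)
qed (auto simp: subst_env_def split: option.split)

lemma subst_env_upd: "subst_env c (\<rho>(v := None)) (e(v := a)) = (subst_env c \<rho> e)(v := a)"
  by (rule ext) (simp add: subst_env_def split: option.split)

text \<open>Parameters contain no variables, so nothing is captured under a quantifier; the bound
  variable only has to be removed from \<open>\<rho>\<close>, which \<open>subst_env_upd\<close>
  handles.\<close>

lemma sat_subst_fm:
  fixes M :: "('s, 'f, 'r, 'm) struct"
  shows "sat M c e (subst_fm \<rho> \<psi>) \<longleftrightarrow> sat M c (subst_env c \<rho> e) \<psi>"
proof (induction \<psi> arbitrary: \<rho> e)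
  case (Rel r ts)
  have "map (eval M c e \<circ> subst_tm \<rho>) ts = map (eval M c (subst_env c \<rho> e)) ts"
    by (simp add: eval_subst_tm)
  then show ?case by (simp only: subst_fm.simps sat.simps map_map)
qed (auto simp: eval_subst_tm subst_env_upd)

lemma has_sort_Var: "has_sort L (Var v) s \<longleftrightarrow> s = fst v"
  by (cases v) (auto intro: has_sort.intros elim: has_sort.cases)

lemma has_sort_subst_tm:
  assumes "has_sort L t s" "sort_preserving \<rho>"
  shows "has_sort L (subst_tm \<rho> t) s"
  using assms(1)
proof (induction rule: has_sort.induct)
  case (1 s i)
  then show ?case
    using assms(2) by (force simp: sort_preserving_def intro: has_sort.intros split: option.split)
next
  case (3 ts f)
  then show ?case by (auto simp: list.rel_map intro!: has_sort.intros elim: list_all2_mono)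
qed (auto intro: has_sort.intros)

lemma sort_preserving_upd: "sort_preserving \<rho> \<Longrightarrow> sort_preserving (\<rho>(v := None))"
  by (auto simp: sort_preserving_def)

lemma wf_subst_fm:
  "wf_fm L \<psi> \<Longrightarrow> sort_preserving \<rho> \<Longrightarrow> wf_fm L (subst_fm \<rho> \<psi>)"
proof (induction \<psi> arbitrary: \<rho>)
  case (Rel r ts)
  then show ?case by (auto simp: list.rel_map intro: has_sort_subst_tm elim: list_all2_mono)
qed (auto intro: has_sort_subst_tm sort_preserving_upd)

lemma tm_params_subst_tm: "tm_params (subst_tm \<rho> t) \<subseteq> tm_params t \<union> ran \<rho>"
  by (induction t) (auto split: option.split simp: ran_def)

lemma tm_vars_subst_tm: "tm_vars (subst_tm \<rho> t) \<subseteq> tm_vars t - dom \<rho>"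
  by (induction t) (fastforce split: option.splits)+

lemma fm_params_subst_fm: "fm_params (subst_fm \<rho> \<psi>) \<subseteq> fm_params \<psi> \<union> ran \<rho>"
proof (induction \<psi> arbitrary: \<rho>)
  case (Eq t t')
  then show ?case using tm_params_subst_tm[of \<rho> t] tm_params_subst_tm[of \<rho> t'] by auto
next
  case (Rel r ts)
  then show ?case using tm_params_subst_tm[of \<rho>] by fastforce
next
  case (Exi v \<psi>)
  have "ran (\<rho>(v := None)) \<subseteq> ran \<rho>" by (auto simp: ran_def)
  then show ?case using Exi.IH[of "\<rho>(v := None)"] by (simp del: fun_upd_apply) blast
qed auto

lemma fv_subst_fm: "fv (subst_fm \<rho> \<psi>) \<subseteq> fv \<psi> - dom \<rho>"
proof (induction \<psi> arbitrary: \<rho>)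
  case (Eq t t')
  then show ?case using tm_vars_subst_tm[of \<rho> t] tm_vars_subst_tm[of \<rho> t'] by auto
next
  case (Rel r ts)
  then show ?case using tm_vars_subst_tm[of \<rho>] by fastforce
next
  case (Neg \<psi>)
  then show ?case by simp
next
  case (Conj \<psi> \<theta>)
  then show ?case by fastforce
next
  case (Exi v \<psi>)
  then show ?case using Exi.IH[of "\<rho>(v := None)"] by (simp del: fun_upd_apply) blast
qed

lemma subst_fm_in_formulas:
  assumes "\<psi> \<in> formulas L B X" "sort_preserving \<rho>"
  shows "subst_fm \<rho> \<psi> \<in> formulas L (B \<union> ran \<rho>) (X - dom \<rho>)"
  using assms wf_subst_fm[of L \<psi> \<rho>] fm_params_subst_fm[of \<rho> \<psi>] fv_subst_fm[of \<rho> \<psi>]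
  unfolding formulas_def by blast

section \<open>Finite conjunctions and existential closures\<close>

text \<open>The empty conjunction is the sentence that some element equals itself, true because
  sorts are nonempty; it adds neither parameters nor free variables.\<close>

definition conj_list :: "('s, 'f, 'r, 'u) form list \<Rightarrow> ('s, 'f, 'r, 'u) form" where
  "conj_list \<psi>s =
     foldr Conj \<psi>s (Exi (undefined, 0) (Eq (Var (undefined, 0)) (Var (undefined, 0))))"

lemma sat_conj_list:
  fixes M :: "('s, 'f, 'r, 'm) struct"
  assumes "e \<in> assignments M"
  shows "sat M c e (conj_list \<psi>s) \<longleftrightarrow> (\<forall>\<psi>\<in>set \<psi>s. sat M c e \<psi>)"
proof -
  have "univ M (undefined :: 's) \<noteq> {}" using assms unfolding assignments_def by fastforce
  then show ?thesis by (induction \<psi>s) (auto simp: conj_list_def)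
qed

lemma conj_list_in_formulas:
  "set \<psi>s \<subseteq> formulas L B X \<Longrightarrow> conj_list \<psi>s \<in> formulas L B X"
  by (induction \<psi>s) (auto simp: conj_list_def formulas_def intro: has_sort.intros)

lemma Exi_in_formulas: "\<psi> \<in> formulas L B (insert v X) \<Longrightarrow> Exi v \<psi> \<in> formulas L B X"
  by (auto simp: formulas_def)

lemma Neg_in_formulas: "\<psi> \<in> formulas L B X \<Longrightarrow> Neg \<psi> \<in> formulas L B X"
  by (auto simp: formulas_def)

lemma Exi_list_in_formulas:
  "\<psi> \<in> formulas L B (set xs \<union> X) \<Longrightarrow> foldr Exi xs \<psi> \<in> formulas L B X"
proof (induction xs arbitrary: X)
  case (Cons v xs)
  then show ?case using Exi_in_formulas[of "foldr Exi xs \<psi>" L B v X] by simp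
qed simp

lemma assignments_upd: "e \<in> assignments M \<Longrightarrow> a \<in> univ M (fst v) \<Longrightarrow> e(v := a) \<in> assignments M"
  unfolding assignments_def mem_Collect_eq fun_upd_def by (simp del: split_paired_All)

lemma sat_Exi_list:
  assumes "e \<in> assignments M"
  shows "sat M c e (foldr Exi xs \<psi>) \<longleftrightarrow>
    (\<exists>e'\<in>assignments M. (\<forall>v. v \<notin> set xs \<longrightarrow> e' v = e v) \<and> sat M c e' \<psi>)"
  using assms
proof (induction xs arbitrary: e)
  case Nil
  have "e' = e" if "\<forall>v. e' v = e v" for e' using that by blast
  then show ?case using Nil by auto
next
  case (Cons v xs)
  show ?case
  proof
    assume "sat M c e (foldr Exi (v # xs) \<psi>)"
    then obtain a where a: "a \<in> univ M (fst v)" "sat M c (e(v := a)) (foldr Exi xs \<psi>)" by auto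
    then obtain e' where "e' \<in> assignments M" "\<forall>w. w \<notin> set xs \<longrightarrow> e' w = (e(v := a)) w" "sat M c e' \<psi>"
      using Cons.IH[OF assignments_upd[OF Cons.prems a(1)]] by blast
    then show "\<exists>e'\<in>assignments M. (\<forall>w. w \<notin> set (v # xs) \<longrightarrow> e' w = e w) \<and> sat M c e' \<psi>"
      by (intro bexI[of _ e']) auto
  next
    assume "\<exists>e'\<in>assignments M. (\<forall>w. w \<notin> set (v # xs) \<longrightarrow> e' w = e w) \<and> sat M c e' \<psi>"
    then obtain e' where e': "e' \<in> assignments M" "\<forall>w. w \<notin> set (v # xs) \<longrightarrow> e' w = e w" "sat M c e' \<psi>"
      by blast
    have a: "e' v \<in> univ M (fst v)" using e'(1) unfolding assignments_def by blast
    have "sat M c (e(v := e' v)) (foldr Exi xs \<psi>)"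
      unfolding Cons.IH[OF assignments_upd[OF Cons.prems a]]
      using e' by (intro bexI[of _ e']) auto
    then show "sat M c e (foldr Exi (v # xs) \<psi>)" using a by auto
  qed
qed

lemma is_structure_assignments_nonempty:
  fixes L :: "('s, 'f, 'r) lang"
  assumes "is_structure L U" shows "assignments U \<noteq> {}"
proof -
  have "\<forall>v :: 's var. \<exists>a. a \<in> univ U (fst v)" using assms unfolding is_structure_def by blast
  then obtain e where "\<forall>v :: 's var. e v \<in> univ U (fst v)" by metis
  then show ?thesis unfolding assignments_def by blast
qed

section \<open>Saturation and consistency\<close>

lemma finite_tm_params: "finite (tm_params t)"
  by (induction t) auto

lemma finite_fm_params: "finite (fm_params \<psi>)"
  by (induction \<psi>) (auto simp: finite_tm_params)

lemma small_Un:
  assumes "infinite (elements U)" "small U X" "small U Y"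
  shows "small U (X \<union> Y)"
  using card_of_Un_ordLess_infinite[OF assms(1)] assms(2,3) unfolding small_def by blast

lemma small_image: "small U X \<Longrightarrow> small U (f ` X)"
  unfolding small_def using card_of_image ordLeq_ordLess_trans by blast

lemma small_finite:
  assumes "infinite (elements U)" "finite X" shows "small U X"
  unfolding small_def using assms by (intro finite_ordLess_infinite card_of_Well_order) (simp_all add: Field_card_of)

lemma small_subset: "small U Y \<Longrightarrow> X \<subseteq> Y \<Longrightarrow> small U X"
  unfolding small_def using card_of_mono1 ordLeq_ordLess_trans by blast

text \<open>A formula has finitely many parameters, so an infinite set of formulas has no more
  parameters than members. Saturation, stated for small parameter sets, thus reaches small sets of
  formulas.\<close>

lemma small_params:
  fixes \<Sigma> :: "('s, 'f, 'r, 'u) form set"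
  assumes inf: "infinite (elements U)" and sm: "small U \<Sigma>"
  shows "small U (\<Union>\<psi>\<in>\<Sigma>. fm_params \<psi>)"
proof (cases "finite \<Sigma>")
  case True
  then show ?thesis using small_finite[OF inf] finite_fm_params by blast
next
  case False
  have "|fm_params \<psi>| \<le>o |\<Sigma>|" for \<psi> :: "('s, 'f, 'r, 'u) form"
    using False by (intro ordLess_imp_ordLeq finite_ordLess_infinite card_of_Well_order)
      (simp_all add: Field_card_of finite_fm_params)
  then have "|\<Union>\<psi>\<in>\<Sigma>. fm_params \<psi>| \<le>o |\<Sigma>|"
    by (intro card_of_UNION_ordLeq_infinite[OF False]) (auto simp: card_of_refl ordIso_imp_ordLeq)
  then show ?thesis using sm ordLeq_ordLess_trans unfolding small_def by blast
qed

text \<open>The formulas equating the n-th variable of one sort with itself are infinitely many, and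
  the monster is larger than the set of formulas.\<close>

lemma monster_infinite:
  fixes L :: "('s, 'f, 'r) lang" and U :: "('s, 'f, 'r, 'u) struct"
  assumes "monster L T U" shows "infinite (elements U)"
proof
  assume fin: "finite (elements U)"
  let ?F = "formulas L {} UNIV :: ('s, 'f, 'r, 'u) form set"
  have "|?F| <o |elements U|" using assms unfolding monster_def small_def by blast
  then have "finite ?F" using fin card_of_ordLeq_finite ordLess_imp_ordLeq by blast
  moreover have "range (\<lambda>n. Eq (Var (undefined, n)) (Var (undefined, n))) \<subseteq> ?F"
    by (auto simp: formulas_def has_sort_Var)
  moreover have "inj (\<lambda>n. Eq (Var (undefined :: 's, n :: nat)) (Var (undefined, n)) :: ('s, 'f, 'r, 'u) form)"
    by (auto simp: inj_def)
  ultimately show False using finite_subset range_inj_infinite by blast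
qed

section \<open>Compactness in the monster model\<close>

lemma saturatedD:
  assumes "saturated L U" "B \<subseteq> elements U" "small U B" "\<Sigma> \<subseteq> formulas L B {v}"
    and "\<And>\<Sigma>0. \<Sigma>0 \<subseteq> \<Sigma> \<Longrightarrow> finite \<Sigma>0 \<Longrightarrow> \<exists>e\<in>assignments U. \<forall>\<psi>\<in>\<Sigma>0. sat U snd e \<psi>"
  shows "\<exists>e\<in>assignments U. \<forall>\<psi>\<in>\<Sigma>. sat U snd e \<psi>"
  by (rule assms(1)[unfolded saturated_def, THEN spec, of B, THEN spec, of v, THEN spec, of \<Sigma>,
        THEN mp]) (intro conjI allI impI assms(2-5))

text \<open>Saturation speaks of one variable. By induction, the type in the other variables
  obtained by quantifying \<open>v\<close> away is realised first; its values then become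
  parameters, leaving a type in \<open>v\<close>.\<close>

lemma saturated_finitely_many_vars:
  fixes L :: "('s, 'f, 'r) lang" and U :: "('s, 'f, 'r, 'u) struct"
  assumes sat: "saturated L U" and ne: "assignments U \<noteq> {}" and inf: "infinite (elements U)"
    and fin: "finite X" and B: "B \<subseteq> elements U" "small U B"
    and \<Sigma>: "\<Sigma> \<subseteq> formulas L B X"
    and fs: "\<And>\<Sigma>0. \<Sigma>0 \<subseteq> \<Sigma> \<Longrightarrow> finite \<Sigma>0 \<Longrightarrow> \<exists>e\<in>assignments U. \<forall>\<psi>\<in>\<Sigma>0. sat U snd e \<psi>"
  shows "\<exists>e\<in>assignments U. \<forall>\<psi>\<in>\<Sigma>. sat U snd e \<psi>"
  using fin \<Sigma> fs
proof (induction X arbitrary: \<Sigma>)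
  case empty
  obtain e where e: "e \<in> assignments U" using ne by blast
  have "sat U snd e \<psi>" if \<psi>: "\<psi> \<in> \<Sigma>" for \<psi>
  proof -
    obtain e' where "e' \<in> assignments U" "sat U snd e' \<psi>" using empty.prems(2)[of "{\<psi>}"] \<psi> by auto
    moreover have "fv \<psi> = {}" using empty.prems(1) \<psi> unfolding formulas_def by blast
    ultimately show ?thesis using sat_cong[of \<psi> e e' U snd] by simp
  qed
  then show ?case using e by blast
next
  case (insert v X)
  \<comment> \<open>Quantifying over conjunctions of finite lists, instead of single formulas,
    secures a common witness for each finite subset of \<open>\<Sigma>\<close> once the values on
    \<open>X\<close> are fixed.\<close>
  define \<Sigma>' where "\<Sigma>' = (\<lambda>\<psi>s. Exi v (conj_list \<psi>s)) ` {\<psi>s. set \<psi>s \<subseteq> \<Sigma>}"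
  have "\<Sigma>' \<subseteq> formulas L B X"
    unfolding \<Sigma>'_def using insert.prems(1)
    by (auto intro!: Exi_in_formulas conj_list_in_formulas)
  moreover have "\<exists>e\<in>assignments U. \<forall>\<psi>\<in>\<Sigma>0. sat U snd e \<psi>" if "\<Sigma>0 \<subseteq> \<Sigma>'" "finite \<Sigma>0" for \<Sigma>0
  proof -
    obtain K where K: "K \<subseteq> {\<psi>s. set \<psi>s \<subseteq> \<Sigma>}" "finite K" "\<Sigma>0 = (\<lambda>\<psi>s. Exi v (conj_list \<psi>s)) ` K"
      using finite_subset_image[OF \<open>finite \<Sigma>0\<close>] \<open>\<Sigma>0 \<subseteq> \<Sigma>'\<close> unfolding \<Sigma>'_def by metis
    have "(\<Union>\<psi>s\<in>K. set \<psi>s) \<subseteq> \<Sigma>" "finite (\<Union>\<psi>s\<in>K. set \<psi>s)" using K(1,2) by auto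
    from insert.prems(2)[OF this] obtain e
      where e: "e \<in> assignments U" "\<forall>\<psi>\<in>(\<Union>\<psi>s\<in>K. set \<psi>s). sat U snd e \<psi>" by blast
    have "sat U snd e (Exi v (conj_list \<psi>s))" if "\<psi>s \<in> K" for \<psi>s
    proof -
      have "e v \<in> univ U (fst v)" using e(1) unfolding assignments_def by blast
      moreover have "sat U snd e (conj_list \<psi>s)" using sat_conj_list[OF e(1)] e(2) that by auto
      ultimately show ?thesis by (auto intro!: bexI[of _ "e v"])
    qed
    then show ?thesis using e(1) K(3) by blast
  qed
  ultimately obtain e where e: "e \<in> assignments U" "\<forall>\<psi>\<in>\<Sigma>'. sat U snd e \<psi>"
    using insert.IH[of \<Sigma>'] by blast
  define \<rho> where "\<rho> = (\<lambda>w. if w \<in> X then Some (fst w, e w) else None)"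
  define C where "C = B \<union> ran \<rho>"
  have dom: "dom \<rho> = X" by (auto simp: \<rho>_def dom_def)
  have ran: "ran \<rho> = (\<lambda>w. (fst w, e w)) ` X"
    by (auto simp: \<rho>_def ran_def image_iff simp del: split_paired_Ex)
  have sp: "sort_preserving \<rho>" by (auto simp: sort_preserving_def \<rho>_def)
  have C: "C \<subseteq> elements U" "small U C"
    using B small_Un[OF inf B(2) small_finite[OF inf]] e(1) insert.hyps(1)
    unfolding C_def ran elements_def assignments_def by auto
  have 1: "subst_fm \<rho> ` \<Sigma> \<subseteq> formulas L C {v}"
  proof
    fix \<theta> assume "\<theta> \<in> subst_fm \<rho> ` \<Sigma>"
    then obtain \<psi> where "\<theta> = subst_fm \<rho> \<psi>" "\<psi> \<in> formulas L B (insert v X)"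
      using insert.prems(1) by blast
    then have "\<theta> \<in> formulas L C (insert v X - X)"
      using subst_fm_in_formulas[OF _ sp] unfolding C_def dom by blast
    then show "\<theta> \<in> formulas L C {v}" unfolding formulas_def by blast
  qed
  have 2: "\<exists>e\<in>assignments U. \<forall>\<psi>\<in>\<Sigma>0. sat U snd e \<psi>"
    if \<Sigma>0: "\<Sigma>0 \<subseteq> subst_fm \<rho> ` \<Sigma>" "finite \<Sigma>0" for \<Sigma>0
  proof -
    obtain K where K: "K \<subseteq> \<Sigma>" "finite K" "\<Sigma>0 = subst_fm \<rho> ` K"
      using finite_subset_image[OF \<Sigma>0(2,1)] by blast
    obtain \<psi>s where \<psi>s: "set \<psi>s = K" using finite_list[OF K(2)] by blast
    then have "Exi v (conj_list \<psi>s) \<in> \<Sigma>'" using K(1) unfolding \<Sigma>'_def by blast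
    then obtain a where a: "a \<in> univ U (fst v)" "sat U snd (e(v := a)) (conj_list \<psi>s)"
      using e(2) by fastforce
    note as = assignments_upd[OF e(1) a(1)]
    have "subst_env snd \<rho> (e(v := a)) = e(v := a)"
      using insert.hyps(2) by (auto simp: subst_env_def \<rho>_def)
    then have "sat U snd (e(v := a)) (subst_fm \<rho> \<psi>)" if "\<psi> \<in> K" for \<psi>
      using a(2) sat_conj_list[OF as, of snd \<psi>s] that \<psi>s by (simp add: sat_subst_fm)
    then show ?thesis using as K(3) by blast
  qed
  from saturatedD[OF sat C 1 2] obtain e'
    where e': "e' \<in> assignments U" "\<forall>\<psi>\<in>subst_fm \<rho> ` \<Sigma>. sat U snd e' \<psi>" by (rule bexE)
  \<comment> \<open>The realisation takes its values on \<open>X\<close> from \<open>e\<close> and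
    elsewhere, in particular at \<open>v\<close>, from \<open>e'\<close>.\<close>
  have "subst_env snd \<rho> e' \<in> assignments U"
    using e(1) e'(1) by (auto simp: subst_env_def \<rho>_def assignments_def)
  moreover have "\<forall>\<psi>\<in>\<Sigma>. sat U snd (subst_env snd \<rho> e') \<psi>"
    using e'(2) by (simp add: sat_subst_fm)
  ultimately show ?case by blast
qed

lemma monster_compactness:
  assumes U: "monster L T U" and \<Sigma>: "\<Sigma> \<subseteq> formulas L (elements U) (set x)" "small U \<Sigma>"
    and fs: "\<And>\<Sigma>0. \<Sigma>0 \<subseteq> \<Sigma> \<Longrightarrow> finite \<Sigma>0 \<Longrightarrow> \<exists>e\<in>assignments U. satisfies U snd e \<Sigma>0"
  shows "\<exists>e\<in>assignments U. satisfies U snd e \<Sigma>"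
proof -
  define B where "B = (\<Union>\<psi>\<in>\<Sigma>. fm_params \<psi>)"
  have st: "saturated L U" "is_structure L U" using U by (auto simp: monster_def models_def)
  have "B \<subseteq> elements U" using \<Sigma>(1) unfolding B_def formulas_def by blast
  moreover have "small U B" unfolding B_def by (rule small_params[OF monster_infinite[OF U] \<Sigma>(2)])
  moreover have "\<Sigma> \<subseteq> formulas L B (set x)" using \<Sigma>(1) unfolding B_def formulas_def by blast
  ultimately show ?thesis
    using saturated_finitely_many_vars[OF st(1) is_structure_assignments_nonempty[OF st(2)]
        monster_infinite[OF U], of "set x" B \<Sigma>] fs
    unfolding satisfies_def by simp
qed

text \<open>The existential closure of the conjunction of \<open>\<Sigma>\<close> is a sentence with
  parameters in \<open>U\<close>; were it false in \<open>U\<close>, its negation would belong to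
  the elementary diagram and hold in the model realising \<open>\<Sigma>\<close>.\<close>

lemma finitely_satisfiable_if_consistent:
  fixes U :: "('s, 'f, 'r, 'u) struct"
  assumes U: "is_structure L U" and \<Sigma>: "\<Sigma> \<subseteq> formulas L (elements U) (set x)" "consistent L U \<Sigma>"
    and fin: "finite \<Sigma>"
  shows "\<exists>e\<in>assignments U. satisfies U snd e \<Sigma>"
proof -
  obtain M c e where M: "diagram_model L U M c" and e: "e \<in> assignments M" "satisfies M c e \<Sigma>"
    using \<Sigma>(2) unfolding consistent_def by blast
  obtain \<psi>s where \<psi>s: "set \<psi>s = \<Sigma>" using finite_list[OF fin] by blast
  define \<sigma> where "\<sigma> = foldr Exi x (conj_list \<psi>s)"
  have \<sigma>: "\<sigma> \<in> formulas L (elements U) {}"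
    unfolding \<sigma>_def
    by (rule Exi_list_in_formulas, rule conj_list_in_formulas) (use \<Sigma>(1) \<psi>s in simp)
  obtain e0 where e0: "e0 \<in> assignments U" using is_structure_assignments_nonempty[OF U] by blast
  have "sat M c e \<sigma>"
    unfolding \<sigma>_def sat_Exi_list[OF e(1)] using e \<psi>s
    by (intro bexI[of _ e]) (auto simp: sat_conj_list satisfies_def)
  moreover have "\<not> sat M c e \<sigma>" if "\<not> sat U snd e0 \<sigma>"
  proof -
    have "fv \<sigma> = {}" using \<sigma> unfolding formulas_def by blast
    then have "\<not> sat U snd e' \<sigma>" for e' using that sat_cong[of \<sigma> e0 e' U snd] by simp
    then have "Neg \<sigma> \<in> elementary_diagram L U"
      unfolding elementary_diagram_def true_in_def using Neg_in_formulas[OF \<sigma>] by simp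
    then have "sat M c e (Neg \<sigma>)"
      using M e(1) unfolding diagram_model_def satisfies_def by blast
    then show ?thesis by simp
  qed
  ultimately have "sat U snd e0 \<sigma>" by blast
  then obtain e' where "e' \<in> assignments U" "sat U snd e' (conj_list \<psi>s)"
    unfolding \<sigma>_def sat_Exi_list[OF e0] by blast
  then show ?thesis using sat_conj_list \<psi>s unfolding satisfies_def by blast
qed

lemma diagram_model_self:
  assumes "is_structure L U" shows "diagram_model L U U snd"
  using assms
  by (auto simp: diagram_model_def elements_def satisfies_def elementary_diagram_def true_in_def)

text \<open>Consistency gives finite satisfiability in \<open>U\<close>, and saturation then a
  realisation; conversely \<open>U\<close> is a model of its own diagram.\<close>

lemma consistent_iff_realised:
  assumes U: "monster L T U" and \<Sigma>: "\<Sigma> \<subseteq> formulas L (elements U) (set x)" "small U \<Sigma>"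
  shows "consistent L U \<Sigma> \<longleftrightarrow> (\<exists>e\<in>assignments U. satisfies U snd e \<Sigma>)"
proof
  have st: "is_structure L U" using U by (simp add: monster_def models_def)
  {
    assume c: "consistent L U \<Sigma>"
    show "\<exists>e\<in>assignments U. satisfies U snd e \<Sigma>"
    proof (rule monster_compactness[OF U \<Sigma>])
      fix \<Sigma>0 assume *: "\<Sigma>0 \<subseteq> \<Sigma>" "finite \<Sigma>0"
      then have "consistent L U \<Sigma>0" using c unfolding consistent_def satisfies_def by blast
      then show "\<exists>e\<in>assignments U. satisfies U snd e \<Sigma>0"
        using finitely_satisfiable_if_consistent[OF st] * \<Sigma>(1) by (meson order_trans)
    qed
  }
  show "consistent L U \<Sigma>" if "\<exists>e\<in>assignments U. satisfies U snd e \<Sigma>"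
    using diagram_model_self[OF st] that unfolding consistent_def by blast
qed

text \<open>A failure of the implication in some model of the diagram makes \<open>\<Sigma>\<close>
  with one negated formula of \<open>\<Gamma>\<close> consistent; being small, that set is realised
  in \<open>U\<close>.\<close>

lemma implies_iff_in_monster:
  assumes U: "monster L T U" and \<Sigma>: "\<Sigma> \<subseteq> formulas L (elements U) (set x)" "small U \<Sigma>"
    and \<Gamma>: "\<Gamma> \<subseteq> formulas L (elements U) (set x)"
  shows "implies L U \<Sigma> \<Gamma> \<longleftrightarrow>
    (\<forall>e\<in>assignments U. satisfies U snd e \<Sigma> \<longrightarrow> satisfies U snd e \<Gamma>)"
proof
  have st: "is_structure L U" using U by (simp add: monster_def models_def)
  show "\<forall>e\<in>assignments U. satisfies U snd e \<Sigma> \<longrightarrow> satisfies U snd e \<Gamma>" if "implies L U \<Sigma> \<Gamma>"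
    using that diagram_model_self[OF st] unfolding implies_def by blast
  assume R: "\<forall>e\<in>assignments U. satisfies U snd e \<Sigma> \<longrightarrow> satisfies U snd e \<Gamma>"
  show "implies L U \<Sigma> \<Gamma>"
    unfolding implies_def
  proof (intro allI impI ballI)
    fix M c e assume M: "diagram_model L U M c" "e \<in> assignments M" "satisfies M c e \<Sigma>"
    show "satisfies M c e \<Gamma>"
      unfolding satisfies_def
    proof (rule ballI, rule ccontr)
      fix \<psi> assume \<psi>: "\<psi> \<in> \<Gamma>" "\<not> sat M c e \<psi>"
      let ?\<Sigma> = "\<Sigma> \<union> {Neg \<psi>}"
      have "satisfies M c e ?\<Sigma>" using M(3) \<psi>(2) unfolding satisfies_def by auto
      then have "consistent L U ?\<Sigma>" using M(1,2) unfolding consistent_def by blast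
      moreover have "?\<Sigma> \<subseteq> formulas L (elements U) (set x)"
        using \<Sigma>(1) \<Gamma> \<psi>(1) Neg_in_formulas by blast
      moreover have "small U ?\<Sigma>"
        using small_Un[OF monster_infinite[OF U] \<Sigma>(2)] small_finite[OF monster_infinite[OF U]] by blast
      ultimately obtain e' where "e' \<in> assignments U" "satisfies U snd e' ?\<Sigma>"
        using consistent_iff_realised[OF U] by blast
      then show False using R \<psi>(1) unfolding satisfies_def by fastforce
    qed
  qed
qed

section \<open>Instances of a formula\<close>

lemma inst_in_formulas:
  assumes \<phi>: "\<phi> \<in> formulas L {} (set (x @ y))" and b: "b \<in> tuples_of_vars U y"
  shows "inst y b \<phi> \<in> formulas L (elements U) (set x)"
proof -
  define \<rho> where "\<rho> = map_of (zip y (zip (map fst y) b))"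
  have len: "length b = length y" using b unfolding tuples_def by (auto dest: list_all2_lengthD)
  have \<rho>: "fst p = fst v \<and> p \<in> elements U" if "\<rho> v = Some p" for v p
  proof -
    have "(v, p) \<in> set (zip y (zip (map fst y) b))" using that unfolding \<rho>_def by (rule map_of_SomeD)
    then obtain i where "i < length y" "v = y ! i" "p = (fst (y ! i), b ! i)"
      using len by (auto simp: set_zip)
    then show ?thesis
      using b unfolding tuples_def elements_def by (auto simp: list_all2_conv_all_nth)
  qed
  then have "sort_preserving \<rho>" "ran \<rho> \<subseteq> elements U" by (auto simp: sort_preserving_def ran_def)
  moreover have "dom \<rho> = set y" unfolding \<rho>_def using len by simp
  ultimately show ?thesis
    using subst_fm_in_formulas[OF \<phi>, of \<rho>] unfolding inst_def \<rho>_def[symmetric] formulas_def by auto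
qed

text \<open>Translates between the tuples used in \<open>vc_dual\<close> and the assignments by
  which realisations are expressed.\<close>

lemma true_in_inst_iff:
  fixes U :: "('s, 'f, 'r, 'u) struct"
  assumes e: "e \<in> assignments U" and fv: "fv \<psi> \<subseteq> set x"
  shows "true_in U (inst x (map e x) \<psi>) \<longleftrightarrow> sat U snd e \<psi>"
proof -
  have "zip (map fst x) (map e x) = map (\<lambda>v. (fst v, e v)) x" by (induction x) auto
  then have "sat U snd e' (inst x (map e x) \<psi>) \<longleftrightarrow> sat U snd e \<psi>" for e'
    unfolding inst_def sat_subst_fm
    using fv by (intro sat_cong) (auto simp: subst_env_def map_of_zip_map)
  then show ?thesis using e unfolding true_in_def by blast
qed

lemma map_in_tuples_of_vars: "e \<in> assignments U \<Longrightarrow> map e x \<in> tuples_of_vars U x"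
  by (simp add: tuples_def assignments_def list_all2_conv_all_nth del: split_paired_All)

section \<open>The types of a formula in a monster model\<close>

locale phi_in_monster =
  fixes L :: "('s, 'f, 'r) lang"
    and T :: "('s, 'f, 'r, 'u) form set"
    and U :: "('s, 'f, 'r, 'u) struct"
    and \<phi> :: "('s, 'f, 'r, 'u) form"
    and x y :: "'s var list"
    and \<pi> :: "('s, 'f, 'r, 'u) form set"
    and A :: "'u list set"
  assumes monster: "monster L T U"
    and phi: "\<phi> \<in> formulas L {} (set (x @ y))"
    and A: "A \<subseteq> tuples_of_vars U y" "small U A"
    and pi: "partial_type L U x \<pi>" "small U \<pi>"
begin

text \<open>The points of the abstract set system. They are not cut down to \<open>A\<close>, since
  \<open>Mod\<close> looks only at the parameters of the given literals.\<close>

definition trace :: "('s var \<Rightarrow> 'u) \<Rightarrow> 'u list set" where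
  "trace e = {b \<in> tuples_of_vars U y. sat U snd e (inst y b \<phi>)}"

definition realisations :: "('s var \<Rightarrow> 'u) set" where
  "realisations = {e \<in> assignments U. satisfies U snd e \<pi>}"

definition traces :: "'u list set set" where
  "traces = trace ` realisations"

definition tp :: "('s var \<Rightarrow> 'u) \<Rightarrow> 'u list set \<Rightarrow> ('s, 'f, 'r, 'u) form set" where
  "tp e B = {\<psi> \<in> phi_literals \<phi> y B. sat U snd e \<psi>}"

lemma phi_literals_mono: "B \<subseteq> C \<Longrightarrow> phi_literals \<phi> y B \<subseteq> phi_literals \<phi> y C"
  unfolding phi_literals_def by blast

lemma phi_literals_in_formulas: "phi_literals \<phi> y A \<subseteq> formulas L (elements U) (set x)"
  using inst_in_formulas[OF phi] A(1) Neg_in_formulas unfolding phi_literals_def by blast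

lemma infinite_elements: "infinite (elements U)"
  by (rule monster_infinite[OF monster])

lemma pi_in_formulas: "\<pi> \<subseteq> formulas L (elements U) (set x)"
  using pi(1) by (simp add: partial_type_def)

lemma small_phi_literals: "small U (phi_literals \<phi> y A)"
  unfolding phi_literals_def
  by (intro small_Un[OF infinite_elements] small_image A(2))

lemma literals_Un_pi:
  assumes "p \<subseteq> phi_literals \<phi> y A"
  shows "p \<union> \<pi> \<subseteq> formulas L (elements U) (set x)" "small U (p \<union> \<pi>)"
  using assms phi_literals_in_formulas pi_in_formulas
    small_Un[OF infinite_elements small_subset[OF small_phi_literals assms] pi(2)] by auto

lemma tp_subset: "tp e B \<subseteq> phi_literals \<phi> y B"
  by (auto simp: tp_def)

text \<open>For each \<open>b\<close> in \<open>B\<close> exactly one of the two literals at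
  \<open>b\<close> is true at \<open>e\<close>, so realising \<open>tp e B\<close> fixes the trace
  on \<open>B\<close>.\<close>

lemma satisfies_tp:
  assumes "B \<subseteq> A"
  shows "satisfies U snd e' (tp e B) \<longleftrightarrow> trace e' \<inter> B = trace e \<inter> B"
proof -
  have "satisfies U snd e' (tp e B) \<longleftrightarrow>
      (\<forall>b\<in>B. sat U snd e' (inst y b \<phi>) \<longleftrightarrow> sat U snd e (inst y b \<phi>))"
    unfolding satisfies_def tp_def phi_literals_def by fastforce
  also have "\<dots> \<longleftrightarrow> (\<forall>b\<in>B. b \<in> trace e' \<longleftrightarrow> b \<in> trace e)"
    using assms A(1) unfolding trace_def by blast
  finally show ?thesis by blast
qed

lemma satisfies_Un: "satisfies U snd e (p \<union> q) \<longleftrightarrow> satisfies U snd e p \<and> satisfies U snd e q"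
  unfolding satisfies_def by blast

lemma satisfies_tp_self: "satisfies U snd e (tp e B)"
  by (simp add: satisfies_def tp_def)

lemma tp_mono: "B \<subseteq> C \<Longrightarrow> tp e B \<subseteq> tp e C"
  unfolding tp_def using phi_literals_mono by blast

lemma tp_eq_iff:
  assumes "B \<subseteq> A" shows "tp e' B = tp e B \<longleftrightarrow> trace e' \<inter> B = trace e \<inter> B"
proof
  assume "tp e' B = tp e B"
  then show "trace e' \<inter> B = trace e \<inter> B"
    using satisfies_tp[OF assms, of e' e] satisfies_tp_self[of e' B] by simp
next
  assume "trace e' \<inter> B = trace e \<inter> B"
  then have "satisfies U snd e' (tp e B)" "satisfies U snd e (tp e' B)"
    using satisfies_tp[OF assms] by simp_all
  then show "tp e' B = tp e B" unfolding satisfies_def tp_def by blast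
qed

lemma type_restrict_tp: "B \<subseteq> C \<Longrightarrow> type_restrict \<phi> y (tp e C) B = tp e B"
  using phi_literals_mono[of B C] by (auto simp: type_restrict_def tp_def)

lemma consistent_literals_iff:
  assumes "p \<subseteq> phi_literals \<phi> y A"
  shows "consistent L U p \<longleftrightarrow> (\<exists>e\<in>assignments U. satisfies U snd e p)"
  using assms phi_literals_in_formulas small_subset[OF small_phi_literals assms]
  by (intro consistent_iff_realised[OF monster, where x = x]) auto

lemma satisfied_subset_tp:
  "p \<subseteq> phi_literals \<phi> y B \<Longrightarrow> satisfies U snd e p \<Longrightarrow> p \<subseteq> tp e B"
  unfolding satisfies_def tp_def by blast

lemma tp_maximal:
  assumes "tp e B \<subseteq> q" "q \<subseteq> phi_literals \<phi> y B" "satisfies U snd e' q"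
  shows "q = tp e B"
proof -
  have "\<psi> \<in> tp e B" if \<psi>: "\<psi> \<in> q" for \<psi>
  proof (rule ccontr)
    assume no: "\<psi> \<notin> tp e B"
    obtain b where b: "b \<in> B" "\<psi> = inst y b \<phi> \<or> \<psi> = Neg (inst y b \<phi>)"
      using assms(2) \<psi> unfolding phi_literals_def by blast
    have "Neg (inst y b \<phi>) \<in> tp e B \<or> inst y b \<phi> \<in> tp e B"
      using b(1) unfolding tp_def phi_literals_def by auto
    moreover have "sat U snd e' \<theta>" if "\<theta> \<in> tp e B" for \<theta>
      using assms(1,3) that unfolding satisfies_def by blast
    moreover have "sat U snd e' \<psi>" using assms(3) \<psi> unfolding satisfies_def by blast
    ultimately show False using b no by fastforce
  qed
  with assms(1) show ?thesis by blast
qed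

lemma phi_types_eq:
  assumes "B \<subseteq> A" shows "phi_types L U \<phi> y B = (\<lambda>e. tp e B) ` assignments U"
proof -
  have cons: "consistent L U p \<longleftrightarrow> (\<exists>e\<in>assignments U. satisfies U snd e p)"
    if "p \<subseteq> phi_literals \<phi> y B" for p
    using consistent_literals_iff that phi_literals_mono[OF assms] by blast
  show ?thesis
  proof (intro equalityI subsetI)
    fix p assume "p \<in> phi_types L U \<phi> y B"
    then have p: "p \<subseteq> phi_literals \<phi> y B" "consistent L U p"
      and max: "\<And>q. p \<subseteq> q \<Longrightarrow> q \<subseteq> phi_literals \<phi> y B \<Longrightarrow> consistent L U q \<Longrightarrow> q = p"
      unfolding phi_types_def by auto
    from p obtain e where e: "e \<in> assignments U" "satisfies U snd e p" using cons by blast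
    have "consistent L U (tp e B)" unfolding cons[OF tp_subset] using e(1) satisfies_tp_self by blast
    then have "tp e B = p" by (intro max satisfied_subset_tp[OF p(1) e(2)] tp_subset)
    then show "p \<in> (\<lambda>e. tp e B) ` assignments U" using e(1) by blast
  next
    fix p assume "p \<in> (\<lambda>e. tp e B) ` assignments U"
    then obtain e where e: "e \<in> assignments U" "p = tp e B" by blast
    have "consistent L U (tp e B)" unfolding cons[OF tp_subset] using e(1) satisfies_tp_self by blast
    moreover have "q = tp e B"
      if "tp e B \<subseteq> q" "q \<subseteq> phi_literals \<phi> y B" "consistent L U q" for q
      using that cons tp_maximal by blast
    ultimately show "p \<in> phi_types L U \<phi> y B"
      unfolding phi_types_def e(2) using tp_subset by simp
  qed
qed

lemma phi_types_mod_eq: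
  assumes "B \<subseteq> A" shows "phi_types_mod L U \<phi> y \<pi> B = (\<lambda>e. tp e B) ` realisations"
proof -
  have sub: "tp e B \<subseteq> phi_literals \<phi> y A" for e using tp_subset phi_literals_mono[OF assms] by blast
  have cons: "consistent L U (tp e B \<union> \<pi>) \<longleftrightarrow>
      (\<exists>e'\<in>realisations. satisfies U snd e' (tp e B))" for e
    unfolding realisations_def
    using consistent_iff_realised[OF monster literals_Un_pi[OF sub]] satisfies_Un by blast
  show ?thesis
  proof (intro equalityI subsetI)
    fix p assume "p \<in> phi_types_mod L U \<phi> y \<pi> B"
    then obtain e where "p = tp e B" "consistent L U (tp e B \<union> \<pi>)"
      unfolding phi_types_mod_def phi_types_eq[OF assms] by blast
    \<comment> \<open>The \<open>e\<close> that gives \<open>p\<close> need not realise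
      \<open>\<pi>\<close>; some other realisation of \<open>p\<close> does.\<close>
    then obtain e' where e': "e' \<in> realisations" "satisfies U snd e' (tp e B)" using cons by blast
    then have "p = tp e' B"
      using satisfies_tp[OF assms, of e' e] tp_eq_iff[OF assms, of e' e] \<open>p = tp e B\<close> by simp
    then show "p \<in> (\<lambda>e. tp e B) ` realisations" using e'(1) by (rule image_eqI)
  next
    fix p assume "p \<in> (\<lambda>e. tp e B) ` realisations"
    then obtain e where e: "e \<in> realisations" "p = tp e B" by blast
    then have "consistent L U (tp e B \<union> \<pi>)" using cons satisfies_tp_self by blast
    then show "p \<in> phi_types_mod L U \<phi> y \<pi> B"
      using e unfolding phi_types_mod_def phi_types_eq[OF assms] realisations_def by blast
  qed
qed

section \<open>Compression of types as compression of traces\<close>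

lemma implies_tp_iff:
  assumes "B \<subseteq> A" "C \<subseteq> A"
  shows "implies L U (tp e B \<union> \<pi>) (tp e C) \<longleftrightarrow>
    Mod traces (lits B (trace e)) \<subseteq> Mod traces (lits C (trace e))"
proof -
  have sub: "tp e D \<subseteq> phi_literals \<phi> y A" if "D \<subseteq> A" for D
    using tp_subset phi_literals_mono[OF that] by blast
  have "implies L U (tp e B \<union> \<pi>) (tp e C) \<longleftrightarrow>
      (\<forall>e'\<in>realisations. trace e' \<inter> B = trace e \<inter> B \<longrightarrow> trace e' \<inter> C = trace e \<inter> C)"
    using implies_iff_in_monster[OF monster literals_Un_pi[OF sub[OF assms(1)]], of "tp e C"]
      sub[OF assms(2)] phi_literals_in_formulas
    unfolding satisfies_Un satisfies_tp[OF assms(1)] satisfies_tp[OF assms(2)] realisations_def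
    by auto
  also have "\<dots> \<longleftrightarrow> Mod traces (lits B (trace e)) \<subseteq> Mod traces (lits C (trace e))"
    unfolding Mod_lits traces_def by auto
  finally show ?thesis .
qed

text \<open>The definition counts parameters, \<open>compr\<close> counts literals. For a complete
  type these agree, as its subsets are the sets \<open>lits D (trace e)\<close> and each parameter
  carries one literal.\<close>

lemma compressible_iff_compr:
  assumes "B \<subseteq> A"
  shows "compressible L U \<phi> y \<pi> B k (tp e B) \<longleftrightarrow> compr traces k (lits B (trace e))"
proof -
  have 1: "compressible L U \<phi> y \<pi> B k (tp e B) \<longleftrightarrow>
    (\<forall>C\<subseteq>B. finite C \<longrightarrow> (\<exists>D\<subseteq>B. finite D \<and> card D \<le> k \<and>
       Mod traces (lits D (trace e)) \<subseteq> Mod traces (lits C (trace e))))"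
    unfolding compressible_def
    by (simp add: type_restrict_tp implies_tp_iff subset_trans[OF _ assms] cong: conj_cong)
  show ?thesis
    unfolding 1
  proof (rule iffI)
    assume H: "\<forall>C\<subseteq>B. finite C \<longrightarrow> (\<exists>D\<subseteq>B. finite D \<and> card D \<le> k \<and>
       Mod traces (lits D (trace e)) \<subseteq> Mod traces (lits C (trace e)))"
    show "compr traces k (lits B (trace e))"
      unfolding compr_def
    proof (intro allI impI)
      fix r assume r: "r \<subseteq> lits B (trace e)" "finite r"
      obtain C where "C \<subseteq> B" "finite C" and r: "r = lits C (trace e)"
        using finite_subset_image[OF r(2) r(1)[unfolded lits_def]] unfolding lits_def by auto
      then obtain D where D: "D \<subseteq> B" "finite D" "card D \<le> k"
        "Mod traces (lits D (trace e)) \<subseteq> Mod traces (lits C (trace e))" using H by auto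
      moreover have "finite (lits D (trace e))" "card (lits D (trace e)) \<le> k"
        using D(2,3) card_image_le[OF D(2)] order_trans unfolding lits_def by auto
      ultimately show "\<exists>s\<subseteq>lits B (trace e). finite s \<and> card s \<le> k \<and> Mod traces s \<subseteq> Mod traces r"
        unfolding r by (intro exI[of _ "lits D (trace e)"]) (simp add: lits_subset)
    qed
  next
    assume H: "compr traces k (lits B (trace e))"
    show "\<forall>C\<subseteq>B. finite C \<longrightarrow> (\<exists>D\<subseteq>B. finite D \<and> card D \<le> k \<and>
       Mod traces (lits D (trace e)) \<subseteq> Mod traces (lits C (trace e)))"
    proof (intro allI impI)
      fix C assume "C \<subseteq> B" "finite C"
      then have "lits C (trace e) \<subseteq> lits B (trace e)" "finite (lits C (trace e))"
        by (auto intro: lits_subset simp: lits_def)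
      from comprE[OF H this] obtain s where s: "s \<subseteq> lits B (trace e)" "finite s" "card s \<le> k"
        "Mod traces s \<subseteq> Mod traces (lits C (trace e))" .
      obtain D where D: "D \<subseteq> B" "finite D" "s = lits D (trace e)"
        using finite_subset_image[OF s(2) s(1)[unfolded lits_def]] unfolding lits_def by auto
      have "inj_on (\<lambda>b. (b, b \<in> trace e)) D" by (auto simp: inj_on_def)
      then have "card D = card s" unfolding D(3) lits_def by (simp add: card_image)
      with s D show "\<exists>D\<subseteq>B. finite D \<and> card D \<le> k \<and>
          Mod traces (lits D (trace e)) \<subseteq> Mod traces (lits C (trace e))"
        by (intro exI[of _ D]) simp
    qed
  qed
qed

lemma compressible_types_eq:
  assumes "B \<subseteq> A"
  shows "compressible_types L U \<phi> y \<pi> k B =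
    (\<lambda>e. tp e B) ` {e \<in> realisations. compr traces k (lits B (trace e))}"
  unfolding compressible_types_def phi_types_mod_eq[OF assms]
  using compressible_iff_compr[OF assms] by blast

lemma realisations_nonempty: "realisations \<noteq> {}"
  using consistent_iff_realised[OF monster pi_in_formulas pi(2)] pi(1)
  unfolding realisations_def partial_type_def by blast

text \<open>Literals over \<open>A\<close> together with \<open>\<pi>\<close> form a small set, so
  saturation realises it as soon as it is finitely satisfiable; the trace of the realisation is the
  point sought.\<close>

lemma compact_traces: "compact_on A traces"
  unfolding compact_on_def
proof (intro allI impI)
  fix q assume q: "q \<subseteq> A \<times> UNIV" and fs: "\<forall>r\<subseteq>q. finite r \<longrightarrow> Mod traces r \<noteq> {}"
  define lit where "lit l = (if snd l then inst y (fst l) \<phi> else Neg (inst y (fst l) \<phi>))"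
    for l :: "'u list \<times> bool"
  have sub: "lit ` q \<subseteq> phi_literals \<phi> y A" using q by (auto simp: lit_def phi_literals_def)
  have lit: "satisfies U snd e (lit ` r) \<longleftrightarrow> (\<forall>(b, v)\<in>r. (b \<in> trace e) = v)" if "r \<subseteq> q" for e r
  proof -
    have "sat U snd e (lit l) \<longleftrightarrow> (fst l \<in> trace e) = snd l" if "l \<in> r" for l
    proof -
      have "fst l \<in> tuples_of_vars U y" using subsetD[OF q] that \<open>r \<subseteq> q\<close> A(1) by fastforce
      then show ?thesis by (auto simp: lit_def trace_def)
    qed
    then show ?thesis unfolding satisfies_def by (auto simp: case_prod_unfold)
  qed
  have "\<exists>e\<in>assignments U. satisfies U snd e (lit ` q \<union> \<pi>)"
  proof (rule monster_compactness[OF monster literals_Un_pi[OF sub]])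
    fix \<Sigma>0 assume \<Sigma>0: "\<Sigma>0 \<subseteq> lit ` q \<union> \<pi>" "finite \<Sigma>0"
    \<comment> \<open>Only the members outside \<open>\<pi>\<close> have to be traced back to
      finitely many literals: each point of \<open>traces\<close> comes from a realisation of all of
      \<open>\<pi>\<close>.\<close>
    have "\<Sigma>0 - \<pi> \<subseteq> lit ` q" "finite (\<Sigma>0 - \<pi>)" using \<Sigma>0 by auto
    from finite_subset_image[OF this(2,1)] obtain r
      where r: "r \<subseteq> q" "finite r" "\<Sigma>0 - \<pi> = lit ` r" by auto
    then have "Mod traces r \<noteq> {}" using fs by simp
    then obtain e where e: "e \<in> realisations" "\<forall>(b, v)\<in>r. (b \<in> trace e) = v"
      unfolding Mod_def traces_def by blast
    have "satisfies U snd e (lit ` r \<union> \<pi>)"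
      unfolding satisfies_Un using lit[OF r(1)] e by (simp add: realisations_def)
    moreover have "\<Sigma>0 \<subseteq> lit ` r \<union> \<pi>" using r(3) by blast
    ultimately show "\<exists>e\<in>assignments U. satisfies U snd e \<Sigma>0"
      using e(1) unfolding realisations_def satisfies_def by blast
  qed
  then obtain e where e: "e \<in> assignments U" "satisfies U snd e (lit ` q)" "satisfies U snd e \<pi>"
    unfolding satisfies_Un by blast
  then have "trace e \<in> Mod traces q"
    using lit[of q e] unfolding Mod_def traces_def realisations_def by simp
  then show "Mod traces q \<noteq> {}" by blast
qed

text \<open>The traces are among the sets whose VC-dimension is \<open>vc_dual\<close>, and
  shattering is monotone in the family.\<close>

lemma vc_traces:
  assumes vc: "vc_dual U \<phi> x y \<le> enat d"
  shows "vc_on_le A traces d"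
  unfolding vc_on_le_def
proof (intro allI impI)
  fix S assume S: "S \<subseteq> A" "finite S" "shatters traces S"
  let ?F = "(\<lambda>a. {b \<in> tuples_of_vars U y. true_in U (inst x a (inst y b \<phi>))}) ` tuples_of_vars U x"
  have "traces \<subseteq> ?F"
  proof
    fix P assume "P \<in> traces"
    then obtain e where e: "e \<in> assignments U" "P = trace e"
      unfolding traces_def realisations_def by blast
    have "true_in U (inst x (map e x) (inst y b \<phi>)) \<longleftrightarrow> sat U snd e (inst y b \<phi>)"
      if "b \<in> tuples_of_vars U y" for b
      using inst_in_formulas[OF phi that] true_in_inst_iff[OF e(1)] unfolding formulas_def by blast
    then have "P = {b \<in> tuples_of_vars U y. true_in U (inst x (map e x) (inst y b \<phi>))}"
      unfolding e(2) trace_def by blast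
    then show "P \<in> ?F" using map_in_tuples_of_vars[OF e(1)] by blast
  qed
  then have "shatters ?F S" using S(3) by (rule shatters_mono)
  then have "enat (card S) \<le> vc_dual U \<phi> x y"
    unfolding vc_dual_def vc_dim_def using S(2) by (intro Sup_upper) blast
  then show "card S \<le> d" using vc by (metis enat_ord_simps(1) order_trans)
qed

section \<open>Existence, extension and density\<close>

lemma compressible_types_nonempty:
  assumes "vc_dual U \<phi> x y \<le> enat d"
  shows "compressible_types L U \<phi> y \<pi> (k_comp d) A \<noteq> {}"
proof -
  have "traces \<noteq> {}" using realisations_nonempty by (simp add: traces_def)
  from exists_compr_point[OF compact_traces this vc_traces[OF assms]] show ?thesis
    unfolding compressible_types_eq[OF order_refl] traces_def by auto
qed

lemma compressible_types_extend:
  assumes vc: "vc_dual U \<phi> x y \<le> enat d" and B: "B \<subseteq> A"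
    and p': "p' \<in> compressible_types L U \<phi> y \<pi> l B"
  shows "\<exists>p\<in>compressible_types L U \<phi> y \<pi> (l + k_comp d) A. p' \<subseteq> p"
proof -
  obtain e' where e': "e' \<in> realisations" "compr traces l (lits B (trace e'))" "p' = tp e' B"
    using p' unfolding compressible_types_eq[OF B] by blast
  have "trace e' \<in> traces" using e'(1) by (simp add: traces_def)
  from compr_extend[OF compact_traces vc_traces[OF vc] B this e'(2)]
  obtain e where e: "e \<in> realisations" "trace e \<inter> B = trace e' \<inter> B"
    "compr traces (l + k_comp d) (lits A (trace e))"
    unfolding traces_def by blast
  have "p' = tp e B" using e(2) tp_eq_iff[OF B] e'(3) by simp
  then have "p' \<subseteq> tp e A" using tp_mono[OF B] by simp
  moreover have "tp e A \<in> compressible_types L U \<phi> y \<pi> (l + k_comp d) A"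
    unfolding compressible_types_eq[OF order_refl] using e by blast
  ultimately show ?thesis by blast
qed

text \<open>A finite type is compressed by all of its literals; this starts the extension used for
  density.\<close>

lemma finite_type_compressible:
  assumes "e \<in> realisations" "B \<subseteq> A" "finite B"
  shows "tp e B \<in> compressible_types L U \<phi> y \<pi> (card B) B"
proof -
  have "compr traces (card B) (lits B (trace e))"
    unfolding compr_def
  proof (intro allI impI)
    fix r assume "r \<subseteq> lits B (trace e)"
    moreover have "card (lits B (trace e)) \<le> card B" "finite (lits B (trace e))"
      using assms(3) by (simp_all add: lits_def card_image_le)
    ultimately show "\<exists>s\<subseteq>lits B (trace e). finite s \<and> card s \<le> card B \<and> Mod traces s \<subseteq> Mod traces r"
      by (intro exI[of _ "lits B (trace e)"]) (simp add: Mod_antimono)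
  qed
  then show ?thesis unfolding compressible_types_eq[OF assms(2)] using assms(1) by blast
qed

lemma inst_in_tp_iff: "b \<in> B \<Longrightarrow> inst y b \<phi> \<in> tp e B \<longleftrightarrow> sat U snd e (inst y b \<phi>)"
  unfolding tp_def phi_literals_def by blast

text \<open>A basic neighbourhood of \<open>p\<close> constrains only a finite \<open>B\<close>; the
  restriction of \<open>p\<close> to \<open>B\<close> is compressible and extends to a compressible
  type over \<open>A\<close>, which lies in the neighbourhood.\<close>

lemma compressible_types_star_dense:
  assumes vc: "vc_dual U \<phi> x y \<le> enat d"
  shows "subtopology (phi_type_space L U \<phi> y A) (phi_types_mod L U \<phi> y \<pi> A)
      closure_of compressible_types_star L U \<phi> y \<pi> A = phi_types_mod L U \<phi> y \<pi> A"
    (is "?X closure_of ?K = ?S")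
proof -
  let ?prod = "product_topology (\<lambda>_. discrete_topology (UNIV :: bool set)) A"
  have S: "?S \<subseteq> phi_types L U \<phi> y A" by (auto simp: phi_types_mod_def)
  have "topspace (phi_type_space L U \<phi> y A) = phi_types L U \<phi> y A"
    unfolding phi_type_space_def topspace_pullback_topology by auto
  then have top: "topspace ?X = ?S" using S by auto
  have K: "?K \<subseteq> ?S" by (auto simp: compressible_types_star_def compressible_types_def)
  have "p \<in> ?X closure_of ?K" if p: "p \<in> ?S" for p
    unfolding in_closure_of top
  proof (intro conjI p allI impI)
    fix V assume "p \<in> V \<and> openin ?X V"
    then have pV: "p \<in> V" and "openin ?X V" by auto
    then obtain W where W: "openin ?prod W"
      "V = ((\<lambda>p. \<lambda>a\<in>A. inst y a \<phi> \<in> p) -` W \<inter> phi_types L U \<phi> y A) \<inter> ?S"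
      unfolding openin_subtopology phi_type_space_def openin_pullback_topology by blast
    let ?g = "\<lambda>p. \<lambda>a\<in>A. inst y a \<phi> \<in> p"
    have "?g p \<in> W" using pV W(2) by blast
    then obtain N where N: "finite {a \<in> A. N a \<noteq> UNIV}" "?g p \<in> Pi\<^sub>E A N" "Pi\<^sub>E A N \<subseteq> W"
      using W(1) unfolding openin_product_topology_alt by auto
    define B where "B = {a \<in> A. N a \<noteq> UNIV}"
    have B: "B \<subseteq> A" "finite B" using N(1) by (auto simp: B_def)
    obtain e where e: "e \<in> realisations" "p = tp e A"
      using p unfolding phi_types_mod_eq[OF order_refl] by blast
    obtain p' where p': "p' \<in> compressible_types L U \<phi> y \<pi> (card B + k_comp d) A" "tp e B \<subseteq> p'"
      using compressible_types_extend[OF vc B(1) finite_type_compressible[OF e(1) B]] by blast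
    then have "p' \<in> ?K" unfolding compressible_types_star_def by blast
    then have "p' \<in> ?S" using K by blast
    then obtain e' where e': "p' = tp e' A" unfolding phi_types_mod_eq[OF order_refl] by blast
    have "satisfies U snd e' (tp e B)"
      using p'(2) unfolding e' satisfies_def tp_def by blast
    then have tr: "trace e' \<inter> B = trace e \<inter> B" using satisfies_tp[OF B(1)] by simp
    have "?g p' a = ?g p a" if "a \<in> B" for a
    proof -
      have "a \<in> A" "a \<in> tuples_of_vars U y" using that B(1) A(1) by auto
      moreover have "a \<in> trace e' \<longleftrightarrow> a \<in> trace e" using tr that by blast
      ultimately show ?thesis by (simp add: e' e(2) inst_in_tp_iff trace_def)
    qed
    \<comment> \<open>At parameters outside \<open>B\<close> the factor \<open>N a\<close> is the
      whole space, so agreement on \<open>B\<close> is enough.\<close>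
    then have "?g p' a \<in> N a" if "a \<in> A" for a
      using that N(2) B_def by (cases "a \<in> B") (auto simp: PiE_iff)
    then have "?g p' \<in> Pi\<^sub>E A N" by (auto simp: PiE_iff)
    then have "?g p' \<in> W" using N(3) by blast
    then have "p' \<in> V" unfolding W(2) using \<open>p' \<in> ?S\<close> S by blast
    with \<open>p' \<in> ?K\<close> show "\<exists>p'. p' \<in> ?K \<and> p' \<in> V" by blast
  qed
  moreover have "?X closure_of ?K \<subseteq> ?S" using closure_of_subset_topspace[of ?X ?K] top by simp
  ultimately show ?thesis by blast
qed

end

theorem corollary3p9:
  fixes L :: "('s, 'f, 'r) lang"
    and T :: "('s, 'f, 'r, 'u) form set"
    and U :: "('s, 'f, 'r, 'u) struct"
    and \<phi> :: "('s, 'f, 'r, 'u) form"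
    and x y :: "'s var list"
    and \<pi> :: "('s, 'f, 'r, 'u) form set"
    and A :: "'u list set"
    and d :: nat
  assumes "complete_theory L T"
    and "monster L T U"
    and "distinct (x @ y)"
    and "\<phi> \<in> formulas L {} (set (x @ y))"
    and "A \<subseteq> tuples_of_vars U y" and "small U A"
    and "partial_type L U x \<pi>" and "small U \<pi>"
    and "NIP U \<phi> x y"
    and "vc_dual U \<phi> x y \<le> enat d"
  shows "compressible_types L U \<phi> y \<pi> (k_comp d) A \<noteq> {} \<and>
    (\<forall>A'\<subseteq>A. \<forall>l. \<forall>p'\<in>compressible_types L U \<phi> y \<pi> l A'.
       \<exists>p\<in>compressible_types L U \<phi> y \<pi> (l + k_comp d) A. p' \<subseteq> p) \<and>
    subtopology (phi_type_space L U \<phi> y A) (phi_types_mod L U \<phi> y \<pi> A)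
      closure_of compressible_types_star L U \<phi> y \<pi> A = phi_types_mod L U \<phi> y \<pi> A"
proof -
  interpret phi_in_monster L T U \<phi> x y \<pi> A
    by unfold_locales (fact assms)+
  show ?thesis
    using compressible_types_nonempty compressible_types_extend compressible_types_star_dense
      assms(10) by simp
qed

end
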